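(* Let $n\geq 5$ be an integer with $n\equiv 1$ or $5 \pmod 6$. Then there exists a regular SAMS$(n,d)$ if and only if $2\leq d\leq n-1$.
   Context: For positive integers $n,d$ with $d<n$, an $n\times n$ array $A$ with entries in $\{0,1,\dots,nd\}$ is a sparse anti-magic square of order $n$ with density $d$, denoted SAMS$(n,d)$, if each element of $\{1,2,\dots,nd\}$ occurs in exactly one entry of $A$ (all other entries being $0$), and the $n$ row-sums, $n$ column-sums and the two main diagonal sums (left diagonal: entries $(i,i)$; right diagonal: entries $(i,n+1-i)$) together form a set of $2n+2$ consecutive integers. An SAMS$(n,d)$ is regular if each row, each column and each of the two main diagonals contains exactly $d$ positive entries. *)

theory Defs
  imports Main
begin

text \<open>
  An \<open>n \<times> n\<close> array is a function \<open>A :: nat \<Rightarrow> nat \<Rightarrow> nat\<close> of which only the values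
  \<open>A i j\<close> with \<open>i, j \<in> {1..n}\<close> matter; all notions below are insensitive to the others.
\<close>

definition row_sum :: "nat \<Rightarrow> (nat \<Rightarrow> nat \<Rightarrow> nat) \<Rightarrow> nat \<Rightarrow> nat" where
  "row_sum n A i = (\<Sum>j = 1..n. A i j)"

definition col_sum :: "nat \<Rightarrow> (nat \<Rightarrow> nat \<Rightarrow> nat) \<Rightarrow> nat \<Rightarrow> nat" where
  "col_sum n A j = (\<Sum>i = 1..n. A i j)"

definition left_diag_sum :: "nat \<Rightarrow> (nat \<Rightarrow> nat \<Rightarrow> nat) \<Rightarrow> nat" where
  "left_diag_sum n A = (\<Sum>i = 1..n. A i i)"

definition right_diag_sum :: "nat \<Rightarrow> (nat \<Rightarrow> nat \<Rightarrow> nat) \<Rightarrow> nat" where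
  "right_diag_sum n A = (\<Sum>i = 1..n. A i (n + 1 - i))"

definition line_sums :: "nat \<Rightarrow> (nat \<Rightarrow> nat \<Rightarrow> nat) \<Rightarrow> nat set" where
  "line_sums n A =
     row_sum n A ` {1..n} \<union> col_sum n A ` {1..n} \<union> {left_diag_sum n A, right_diag_sum n A}"

text \<open>
  The interval in the last clause has exactly \<open>2 * n + 2\<close> elements, so it forces the
  \<open>2 * n + 2\<close> line sums to be pairwise distinct.
\<close>

definition sams :: "nat \<Rightarrow> nat \<Rightarrow> (nat \<Rightarrow> nat \<Rightarrow> nat) \<Rightarrow> bool" where
  "sams n d A \<longleftrightarrow>
     0 < d \<and> d < n \<and>
     (\<forall>i\<in>{1..n}. \<forall>j\<in>{1..n}. A i j \<in> {0..n * d}) \<and>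
     (\<forall>k\<in>{1..n * d}. \<exists>!p. p \<in> {1..n} \<times> {1..n} \<and> A (fst p) (snd p) = k) \<and>
     (\<exists>s. line_sums n A = {s..<s + (2 * n + 2)})"

definition regular_sams :: "nat \<Rightarrow> nat \<Rightarrow> (nat \<Rightarrow> nat \<Rightarrow> nat) \<Rightarrow> bool" where
  "regular_sams n d A \<longleftrightarrow>
     sams n d A \<and>
     (\<forall>i\<in>{1..n}. card {j \<in> {1..n}. 0 < A i j} = d) \<and>
     (\<forall>j\<in>{1..n}. card {i \<in> {1..n}. 0 < A i j} = d) \<and>
     card {i \<in> {1..n}. 0 < A i i} = d \<and>
     card {i \<in> {1..n}. 0 < A i (n + 1 - i)} = d"

end

theory Submission
  imports Defs
begin

text \<open>
  With the centre of the square as origin, the cells \<open>(x, 2 * x + c)\<close> modulo \<open>n\<close> form, for each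
  residue \<open>c\<close>, a transversal that also meets both diagonals exactly once, because \<open>n\<close> is coprime
  to \<open>6\<close>. A regular array of density \<open>d\<close> results from filling \<open>d\<close> of these \<open>n\<close> transversals.

  Four transversals \<open>x, y, - x, - y\<close> can be filled so that all line sums are equal; after a shift of
  the labels this fill can be added to any solution, raising \<open>d\<close> by \<open>4\<close>. The solutions to start
  from have density \<open>2\<close>, \<open>3\<close>, \<open>4\<close>, \<open>5 = 2 + 3\<close> and \<open>8 = 2 + 6\<close>, where \<open>3\<close> and \<open>6\<close> in the two sums
  again stand for fills with equal line sums; \<open>8\<close> is needed because the solution of density \<open>4\<close> lies on
  transversals that are not symmetric about the centre.

  Density \<open>1\<close> is impossible: all line sums would be at most \<open>n\<close>, but there are \<open>2 * n + 2\<close> of them.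
\<close>

text \<open>Slope \<open>2\<close> works because columns need \<open>2\<close> to be invertible
  modulo \<open>n\<close>, and the diagonals, of slopes \<open>1\<close> and \<open>- 1\<close>,
  need \<open>2 - 1 = 1\<close> and \<open>2 + 1 = 3\<close> to be. The extension uses four
  transversals because two can never have equal line sums: their cells form cycles in which
  consecutive cells share a row or a column, and constant sums would force labels two steps apart to
  agree. In the general starting solutions of density \<open>2\<close>, \<open>3\<close> and
  \<open>4\<close>, rows and columns miss exactly two of the \<open>2 * n + 2\<close> required
  values, and the two diagonals must hit these gaps. A common shift of the row argument in all
  classes leaves the sets of row sums and column sums unchanged but alters the diagonals. This shift
  and the choice of the classes are the freedom by which the diagonals are adjusted; offsets such as
  \<open>p\<close> and classes such as \<open>- 7\<close>, \<open>29\<close> and \<open>33\<close>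
  serve that purpose.\<close>

lemma card_line_sums_le:
  "card (line_sums n A) \<le> 2 * n + 2"
proof -
  have "card (line_sums n A)
      \<le> card (row_sum n A ` {1..n}) + card (col_sum n A ` {1..n})
        + card {left_diag_sum n A, right_diag_sum n A}"
    unfolding line_sums_def by (meson add_mono card_Un_le le_refl order_trans)
  also have "\<dots> \<le> n + n + 2"
    by (intro add_mono order_trans[OF card_image_le]) (auto simp: card_insert_if)
  finally show ?thesis by simp
qed

text \<open>\<open>h\<close> and \<open>t\<close> are the inverses of \<open>2\<close> and
  \<open>3\<close> modulo \<open>n\<close>. The sign in \<open>t_inverse\<close> separates the two
  residues modulo \<open>6\<close>: \<open>3 * t = 1 + n\<close> belongs to \<open>5\<close> and
  \<open>3 * t = 1 - n\<close> to \<open>1\<close>. Explicit representatives allow congruences to be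
  checked as polynomial identities.\<close>

locale odd_order =
  fixes n m h t :: int
  assumes m_ge_2: "m \<ge> 2"
    and n_def: "n = 2 * m + 1"
    and h_def: "h = m + 1"
    and t_inverse: "3 * t = 1 + n \<or> 3 * t = 1 - n"
begin

lemma n_pos [simp]: "0 < n" "0 \<le> n" "n \<noteq> 0"
  using m_ge_2 n_def by auto

lemma two_h: "2 * h = n + 1"
  by (simp add: n_def h_def)

text \<open>
  \<open>G c i\<close> is the entry of transversal \<open>c\<close> in row \<open>i\<close>, where rows are residues modulo \<open>n\<close> counted from
  the middle row. Since \<open>h\<close> is the inverse of \<open>2\<close>, the transversal meets column \<open>2 * u\<close> in row
  \<open>u - h * c\<close>. It meets the left diagonal in row \<open>- c\<close>, and the right one in row \<open>- c / 3 = - t * c\<close>.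
  Numbering the columns by \<open>u\<close> is harmless because only the set of column sums matters.
\<close>

definition row :: "int set \<Rightarrow> (int \<Rightarrow> int \<Rightarrow> int) \<Rightarrow> int \<Rightarrow> int" where
  "row C G i = (\<Sum>c\<in>C. G c (i mod n))"

definition col :: "int set \<Rightarrow> (int \<Rightarrow> int \<Rightarrow> int) \<Rightarrow> int \<Rightarrow> int" where
  "col C G u = (\<Sum>c\<in>C. G c ((u - h * c) mod n))"

definition ldiag :: "int set \<Rightarrow> (int \<Rightarrow> int \<Rightarrow> int) \<Rightarrow> int" where
  "ldiag C G = (\<Sum>c\<in>C. G c ((- c) mod n))"

definition rdiag :: "int set \<Rightarrow> (int \<Rightarrow> int \<Rightarrow> int) \<Rightarrow> int" where
  "rdiag C G = (\<Sum>c\<in>C. G c ((- t * c) mod n))"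

text \<open>Covering the labels is enough: there are as many cells as labels, so counting makes it a
  bijection (\<open>filling_bij\<close>). The members of \<open>C\<close> are integers standing for
  distinct residues, so negative and large representatives are allowed.\<close>

definition filling :: "int set \<Rightarrow> (int \<Rightarrow> int \<Rightarrow> int) \<Rightarrow> bool" where
  "filling C G \<longleftrightarrow> finite C \<and> inj_on (\<lambda>c. c mod n) C \<and>
     {1..n * int (card C)} \<subseteq> (\<lambda>(c, i). G c i) ` (C \<times> {0..<n})"

text \<open>An inclusion suffices again, since \<open>2 * n + 2\<close> lines have at most
  \<open>2 * n + 2\<close> different sums.\<close>

definition antimagic :: "int set \<Rightarrow> (int \<Rightarrow> int \<Rightarrow> int) \<Rightarrow> bool" where
  "antimagic C G \<longleftrightarrow> filling C G \<and>
     (\<exists>s. {s..<s + 2 * n + 2} \<subseteq>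
        row C G ` {0..<n} \<union> col C G ` {0..<n} \<union> {ldiag C G, rdiag C G})"

text \<open>The entry in row \<open>x\<close> and column \<open>y\<close>, both counted from the
  centre. The sum only selects the transversal through that cell and gives \<open>0\<close> if there
  is none; as a sum it can be interchanged with summation along a line.\<close>

definition cell :: "int set \<Rightarrow> (int \<Rightarrow> int \<Rightarrow> int) \<Rightarrow> int \<Rightarrow> int \<Rightarrow> int" where
  "cell C G x y = (\<Sum>c\<in>C. if n dvd (y - 2 * x - c) then G c (x mod n) else 0)"

section \<open>Residues modulo \<open>n\<close> and the line sums of the array\<close>

lemma mod_eqI: "n dvd (a - b) \<Longrightarrow> a mod n = b mod n"
  by (simp add: mod_eq_dvd_iff)

text \<open>Congruences are proved from an explicit certificate \<open>a\<close>, \<open>b\<close>,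
  which leaves only a polynomial identity to check. \<open>mod_shift\<close> plays the same role for
  equations between residues.\<close>

lemma dvd_combine: "n dvd w \<Longrightarrow> z = n * a + b * w \<Longrightarrow> n dvd z"
  by simp

lemma residue_iff:
  assumes "r \<in> {0..<n}"
  shows "n dvd (r - w) \<longleftrightarrow> r = w mod n"
  using assms by (metis atLeastLessThan_iff mod_eq_dvd_iff mod_pos_pos_trivial)

lemma mod_in_residues [simp]: "a mod n \<in> {0..<n}"
  by simp

lemma dvd_mod_iff: "n dvd (p + k * (x mod n)) \<longleftrightarrow> n dvd (p + k * x)"
proof -
  have "p + k * x = n * (k * (x div n)) + (p + k * (x mod n))"
    by (subst mult_div_mod_eq[of n x, symmetric]) (simp only: algebra_simps)
  then show ?thesis by (metis dvd_add_right_iff dvd_triv_left)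
qed

lemma cell_mod: "cell C G (x mod n) (y mod n) = cell C G x y"
proof -
  have "n dvd (y mod n - 2 * (x mod n) - c) \<longleftrightarrow> n dvd (y - 2 * x - c)" for c
    using dvd_mod_iff[of "y mod n - c" "-2" x] dvd_mod_iff[of "- c - 2 * x" 1 y]
    by (simp add: algebra_simps)
  then show ?thesis by (simp add: cell_def cong: if_cong)
qed

lemma bij_residue: "bij_betw (\<lambda>i. (int i - h) mod n) {1..nat n} {0..<n}"
proof -
  have inj: "inj_on (\<lambda>i. (int i - h) mod n) {1..nat n}"
  proof (rule inj_onI)
    fix i j assume ij: "i \<in> {1..nat n}" "j \<in> {1..nat n}" "(int i - h) mod n = (int j - h) mod n"
    then have "n dvd (int i - int j)" by (simp add: mod_eq_dvd_iff)
    moreover have "\<bar>int i - int j\<bar> < n" using ij by auto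
    ultimately show "i = j" using zdvd_imp_le[of n "\<bar>int i - int j\<bar>"] by force
  qed
  have "(\<lambda>i. (int i - h) mod n) ` {1..nat n} \<subseteq> {0..<n}" by auto
  moreover have "card ((\<lambda>i. (int i - h) mod n) ` {1..nat n}) = card {0..<n}"
    using card_image[OF inj] by simp
  ultimately have "(\<lambda>i. (int i - h) mod n) ` {1..nat n} = {0..<n}"
    by (intro card_subset_eq) auto
  with inj show ?thesis by (simp add: bij_betw_def)
qed

lemma residue_exists: "\<exists>i\<in>{1..nat n}. (int i - h) mod n = x mod n"
proof -
  have "x mod n \<in> (\<lambda>i. (int i - h) mod n) ` {1..nat n}"
    using bij_residue mod_in_residues unfolding bij_betw_def by blast
  then show ?thesis by (metis (no_types, lifting) imageE)
qed

text \<open>The common core of the line sums: \<open>P c r\<close> says that position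
  \<open>r\<close> of the line lies on transversal \<open>c\<close>, and the hypothesis says that
  the line meets that transversal exactly once, at \<open>k c\<close>.\<close>

lemma sum_delta_residue:
  assumes "finite C"
    and "\<And>c r. c \<in> C \<Longrightarrow> r \<in> {0..<n} \<Longrightarrow> P c r \<longleftrightarrow> r = k c mod n"
  shows "(\<Sum>r\<in>{0..<n}. \<Sum>c\<in>C. if P c r then g c r else 0) = (\<Sum>c\<in>C. g c (k c mod n) :: int)"
proof -
  have "(\<Sum>r\<in>{0..<n}. \<Sum>c\<in>C. if P c r then g c r else 0)
      = (\<Sum>c\<in>C. \<Sum>r\<in>{0..<n}. if r = k c mod n then g c r else 0)"
    using assms(2) by (subst sum.swap) (intro sum.cong, auto)
  also have "\<dots> = (\<Sum>c\<in>C. g c (k c mod n))"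
    by (intro sum.cong) (auto simp: sum.delta)
  finally show ?thesis .
qed

lemma sum_reindex_residue:
  "(\<Sum>i = 1..nat n. f ((int i - h) mod n)) = (\<Sum>r\<in>{0..<n}. f r :: int)"
  using sum.reindex_bij_betw[OF bij_residue] by auto

lemma sum_cell_row:
  assumes "finite C"
  shows "(\<Sum>j = 1..nat n. cell C G x (int j - h)) = row C G x"
proof -
  have "(\<Sum>j = 1..nat n. cell C G x (int j - h))
      = (\<Sum>j = 1..nat n. cell C G (x mod n) ((int j - h) mod n))"
    by (simp add: cell_mod)
  also have "\<dots> = (\<Sum>r\<in>{0..<n}. cell C G (x mod n) r)"
    by (rule sum_reindex_residue)
  also have "\<dots> = (\<Sum>c\<in>C. G c (x mod n))"
    unfolding cell_def mod_mod_trivial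
    by (rule sum_delta_residue[where k = "\<lambda>c. 2 * (x mod n) + c" and g = "\<lambda>c _. G c (x mod n)"])
       (use assms residue_iff in \<open>auto simp: algebra_simps\<close>)
  finally show ?thesis by (simp add: row_def)
qed

lemma sum_cell_col:
  assumes "finite C"
  shows "(\<Sum>i = 1..nat n. cell C G (int i - h) y) = col C G (h * y)"
proof -
  have *: "n dvd (y mod n - 2 * r - c) \<longleftrightarrow> r = (h * y - h * c) mod n"
    if "r \<in> {0..<n}" for r c
  proof -
    have "n dvd (y mod n - 2 * r - c) \<longleftrightarrow> n dvd (y - 2 * r - c)"
      using dvd_mod_iff[of "- 2 * r - c" 1 y] by (simp add: algebra_simps)
    also have "\<dots> \<longleftrightarrow> n dvd (r - (h * y - h * c))"
    proof
      assume "n dvd (y - 2 * r - c)"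
      then show "n dvd (r - (h * y - h * c))"
        by (rule dvd_combine[where a = "- r" and b = "- h"]) (use two_h in algebra)
    next
      assume "n dvd (r - (h * y - h * c))"
      then show "n dvd (y - 2 * r - c)"
        by (rule dvd_combine[where a = "c - y" and b = "- 2"]) (use two_h in algebra)
    qed
    finally show ?thesis unfolding residue_iff[OF that] .
  qed
  have "(\<Sum>i = 1..nat n. cell C G (int i - h) y)
      = (\<Sum>i = 1..nat n. cell C G ((int i - h) mod n) (y mod n))"
    by (simp add: cell_mod)
  also have "\<dots> = (\<Sum>r\<in>{0..<n}. cell C G r (y mod n))"
    by (rule sum_reindex_residue)
  also have "\<dots> = (\<Sum>r\<in>{0..<n}. \<Sum>c\<in>C. if n dvd (y mod n - 2 * r - c) then G c r else 0)"
    unfolding cell_def by (intro sum.cong refl) auto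
  also have "\<dots> = (\<Sum>c\<in>C. G c ((h * y - h * c) mod n))"
    by (rule sum_delta_residue) (use assms * in auto)
  finally show ?thesis by (simp add: col_def)
qed

lemma sum_cell_ldiag:
  assumes "finite C"
  shows "(\<Sum>i = 1..nat n. cell C G (int i - h) (int i - h)) = ldiag C G"
proof -
  have *: "n dvd (r - 2 * r - c) \<longleftrightarrow> r = (- c) mod n" if "r \<in> {0..<n}" for r c
  proof -
    have "n dvd (r - 2 * r - c) \<longleftrightarrow> n dvd (r - (- c))"
      by (auto intro: dvd_combine[where a = 0 and b = "- 1"])
    then show ?thesis unfolding residue_iff[OF that] .
  qed
  have "(\<Sum>i = 1..nat n. cell C G (int i - h) (int i - h))
      = (\<Sum>i = 1..nat n. cell C G ((int i - h) mod n) ((int i - h) mod n))"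
    by (simp add: cell_mod)
  also have "\<dots> = (\<Sum>r\<in>{0..<n}. cell C G r r)"
    by (rule sum_reindex_residue)
  also have "\<dots> = (\<Sum>r\<in>{0..<n}. \<Sum>c\<in>C. if n dvd (r - 2 * r - c) then G c r else 0)"
    unfolding cell_def by (intro sum.cong refl) auto
  also have "\<dots> = (\<Sum>c\<in>C. G c ((- c) mod n))"
    by (rule sum_delta_residue) (simp_all only: assms *)
  finally show ?thesis by (simp add: ldiag_def)
qed

lemma sum_cell_rdiag:
  assumes "finite C"
  shows "(\<Sum>i = 1..nat n. cell C G (int i - h) (- (int i - h))) = rdiag C G"
proof -
  obtain k where k: "3 * t = 1 + n * k" using t_inverse by (metis add.commute diff_conv_add_uminus mult.right_neutral mult_minus1_right)
  have *: "n dvd (- r - 2 * r - c) \<longleftrightarrow> r = (- t * c) mod n" if "r \<in> {0..<n}" for r c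
  proof -
    have "n dvd (- r - 2 * r - c) \<longleftrightarrow> n dvd (r - (- t * c))"
    proof
      assume "n dvd (- r - 2 * r - c)"
      then show "n dvd (r - (- t * c))"
        by (rule dvd_combine[where a = "- k * r" and b = "- t"]) (use k in algebra)
    next
      assume "n dvd (r - (- t * c))"
      then show "n dvd (- r - 2 * r - c)"
        by (rule dvd_combine[where a = "k * c" and b = "- 3"]) (use k in algebra)
    qed
    then show ?thesis unfolding residue_iff[OF that] .
  qed
  have "(\<Sum>i = 1..nat n. cell C G (int i - h) (- (int i - h)))
      = (\<Sum>i = 1..nat n. cell C G ((int i - h) mod n) ((- ((int i - h) mod n)) mod n))"
    by (subst cell_mod[symmetric]) (simp add: mod_minus_eq)
  also have "\<dots> = (\<Sum>r\<in>{0..<n}. cell C G r ((- r) mod n))"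
    by (rule sum_reindex_residue)
  also have "\<dots> = (\<Sum>r\<in>{0..<n}. cell C G r (- r))"
    by (intro sum.cong refl, subst (2) cell_mod[symmetric]) simp
  also have "\<dots> = (\<Sum>r\<in>{0..<n}. \<Sum>c\<in>C. if n dvd (- r - 2 * r - c) then G c r else 0)"
    unfolding cell_def by (intro sum.cong refl) auto
  also have "\<dots> = (\<Sum>c\<in>C. G c ((- t * c) mod n))"
    by (rule sum_delta_residue) (simp_all only: assms *)
  finally show ?thesis by (simp add: rdiag_def)
qed

subsection \<open>From transversals to arrays\<close>

lemma filling_bij:
  assumes "filling C G"
  shows "bij_betw (\<lambda>(c, i). G c i) (C \<times> {0..<n}) {1..n * int (card C)}"
proof -
  let ?g = "\<lambda>(c, i). G c i" and ?D = "C \<times> {0..<n}"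
  have fin: "finite ?D" and sub: "{1..n * int (card C)} \<subseteq> ?g ` ?D"
    using assms by (auto simp: filling_def)
  have "card ?D = card {1..n * int (card C)}"
    by (simp add: card_cartesian_product nat_mult_distrib mult.commute)
  moreover have "card {1..n * int (card C)} \<le> card (?g ` ?D)"
    using fin sub by (intro card_mono) auto
  ultimately have eq: "card (?g ` ?D) = card ?D"
    using card_image_le[OF fin, of ?g] by simp
  then have "inj_on ?g ?D" using fin by (rule eq_card_imp_inj_on[rotated])
  moreover have "?g ` ?D = {1..n * int (card C)}"
    using fin sub eq \<open>card ?D = card {1..n * int (card C)}\<close>
    by (intro card_seteq[symmetric]) auto
  ultimately show ?thesis by (simp add: bij_betw_def)
qed

lemma filling_range:
  assumes "filling C G" "c \<in> C" "i \<in> {0..<n}"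
  shows "G c i \<in> {1..n * int (card C)}"
  using bij_betwE[OF filling_bij[OF assms(1)]] assms(2,3) by auto

lemma filling_inj:
  assumes "filling C G" "c \<in> C" "c' \<in> C" "i \<in> {0..<n}" "i' \<in> {0..<n}" "G c i = G c' i'"
  shows "c = c' \<and> i = i'"
  using inj_onD[OF bij_betw_imp_inj_on[OF filling_bij[OF assms(1)]], of "(c, i)" "(c', i')"]
    assms(2-6) by auto

text \<open>\<open>F\<close> is unrelated to \<open>G\<close>; only the distinctness of the residues
  in \<open>C\<close> is drawn from \<open>filling C G\<close>. This permits counting cells with a
  constant \<open>F\<close>.\<close>

lemma cell_eq:
  assumes "filling C G" "c \<in> C" "n dvd (y - 2 * x - c)"
  shows "cell C F x y = F c (x mod n)"
proof -
  have "n dvd (y - 2 * x - c') \<longleftrightarrow> c' = c" if "c' \<in> C" for c'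
  proof
    assume "n dvd (y - 2 * x - c')"
    then have "n dvd (y - 2 * x - c) - (y - 2 * x - c')" using assms(3) by (rule dvd_diff[rotated])
    then have "n dvd c' - c" by (simp add: algebra_simps)
    then have "c' mod n = c mod n" by (rule mod_eqI)
    then show "c' = c" using assms(1,2) that by (auto simp: filling_def inj_on_def)
  qed (use assms in simp)
  then have "cell C F x y = (\<Sum>c'\<in>C. if c' = c then F c' (x mod n) else 0)"
    unfolding cell_def by (intro sum.cong) auto
  then show ?thesis using assms by (simp add: filling_def)
qed

lemma cell_cases:
  assumes "filling C G"
  obtains c where "c \<in> C" "n dvd (y - 2 * x - c)" "\<And>F. cell C F x y = F c (x mod n)"
  | "\<And>F. cell C F x y = 0"
proof (cases "\<exists>c\<in>C. n dvd (y - 2 * x - c)")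
  case True
  then show ?thesis using that(1) cell_eq[OF assms] by blast
next
  case False
  then have "cell C F x y = 0" for F unfolding cell_def by (intro sum.neutral) auto
  then show ?thesis by (rule that(2))
qed

text \<open>The second part expresses the number of positive entries on a line as the line sum of
  the constant fill \<open>1\<close>, so regularity follows from the same lemmas as the line
  sums.\<close>

lemma cell_range:
  assumes "filling C G"
  shows "cell C G x y \<in> {0..n * int (card C)}"
    and "(if 0 < cell C G x y then 1 else 0) = cell C (\<lambda>_ _. 1) x y"
proof -
  have "cell C G x y \<in> {0..n * int (card C)} \<and>
    (if 0 < cell C G x y then 1 else 0) = cell C (\<lambda>_ _. 1) x y"
  proof (cases rule: cell_cases[OF assms, of y x])
    case (1 c)
    have "G c (x mod n) \<in> {1..n * int (card C)}"
      using filling_range[OF assms 1(1)] mod_in_residues by blast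
    then show ?thesis using 1(3) by simp
  next
    case 2
    then show ?thesis by simp
  qed
  then show "cell C G x y \<in> {0..n * int (card C)}"
    and "(if 0 < cell C G x y then 1 else 0) = cell C (\<lambda>_ _. 1) x y" by blast+
qed

theorem antimagic_imp_regular_sams:
  assumes "antimagic C G" "0 < card C" "int (card C) < n"
  shows "\<exists>A. regular_sams (nat n) (card C) A"
proof -
  let ?N = "nat n" and ?d = "card C"
  define A where "A i j = nat (cell C G (int i - h) (int j - h))" for i j
  have fill: "filling C G" and fin: "finite C"
    using assms(1) by (auto simp: antimagic_def filling_def)
  have intA: "int (A i j) = cell C G (int i - h) (int j - h)" for i j
    using cell_range(1)[OF fill] by (simp add: A_def)
  have posA: "int (card {i \<in> {1..?N}. 0 < A (f i) (g i)})
      = (\<Sum>i = 1..?N. cell C (\<lambda>_ _. 1) (int (f i) - h) (int (g i) - h))" for f g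
  proof -
    have "card {i \<in> {1..?N}. 0 < A (f i) (g i)} = (\<Sum>i = 1..?N. if 0 < A (f i) (g i) then 1 else 0)"
      by (simp add: sum.If_cases Int_def)
    then have "int (card {i \<in> {1..?N}. 0 < A (f i) (g i)})
        = (\<Sum>i = 1..?N. if 0 < int (A (f i) (g i)) then 1 else 0)"
      by (simp only: of_nat_sum of_nat_0_less_iff if_distrib[of int] of_nat_1 of_nat_0)
    then show ?thesis unfolding intA cell_range(2)[OF fill] .
  qed
  have refl_idx: "int (?N + 1 - i) - h = - (int i - h)" if "i \<in> {1..?N}" for i
    using that m_ge_2 by (simp add: of_nat_diff n_def h_def)
  have rowA: "int (row_sum ?N A i) = row C G (int i - h)" for i
    by (simp only: row_sum_def of_nat_sum intA sum_cell_row[OF fin])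
  have colA: "int (col_sum ?N A j) = col C G (h * (int j - h))" for j
    by (simp only: col_sum_def of_nat_sum intA sum_cell_col[OF fin])
  have ldiagA: "int (left_diag_sum ?N A) = ldiag C G"
    by (simp only: left_diag_sum_def of_nat_sum intA sum_cell_ldiag[OF fin])
  have rdiagA: "int (right_diag_sum ?N A) = rdiag C G"
    unfolding right_diag_sum_def of_nat_sum intA sum_cell_rdiag[OF fin, symmetric]
    by (intro sum.cong refl) (simp only: refl_idx)
  obtain s where s: "{s..<s + 2 * n + 2} \<subseteq>
        row C G ` {0..<n} \<union> col C G ` {0..<n} \<union> {ldiag C G, rdiag C G}"
    using assms(1) by (auto simp: antimagic_def)
  have sub: "{s..<s + 2 * n + 2} \<subseteq> int ` line_sums ?N A"
  proof -
    have "row C G r \<in> int ` line_sums ?N A" for r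
    proof -
      obtain i where i: "i \<in> {1..?N}" "(int i - h) mod n = r mod n" using residue_exists by blast
      then have "row C G r = int (row_sum ?N A i)" by (simp add: rowA row_def)
      then show ?thesis using i(1) unfolding line_sums_def by blast
    qed
    moreover have "col C G u \<in> int ` line_sums ?N A" for u
    proof -
      \<comment> \<open>Column number \<open>u\<close> stands for the actual column
        \<open>2 * u\<close>.\<close>
      obtain j where j: "j \<in> {1..?N}" "(int j - h) mod n = (2 * u) mod n"
        using residue_exists by blast
      have "(h * (int j - h) - h * c) mod n = (u - h * c) mod n" for c
      proof (rule mod_eqI)
        have "n dvd (int j - h - 2 * u)" using j(2) by (simp add: mod_eq_dvd_iff)
        then show "n dvd (h * (int j - h) - h * c - (u - h * c))"
          by (rule dvd_combine[where a = u and b = h]) (use two_h in algebra)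
      qed
      then have "col C G u = int (col_sum ?N A j)" by (simp add: colA col_def)
      then show ?thesis using j(1) unfolding line_sums_def by blast
    qed
    moreover have "ldiag C G \<in> int ` line_sums ?N A" "rdiag C G \<in> int ` line_sums ?N A"
      unfolding line_sums_def ldiagA[symmetric] rdiagA[symmetric] by blast+
    ultimately show ?thesis using s by blast
  qed
  \<comment> \<open>\<open>s\<close> is itself a line sum of natural numbers, hence nonnegative, and
    the interval survives the passage to \<open>nat s\<close>.\<close>
  have "s \<in> {s..<s + 2 * n + 2}" unfolding atLeastLessThan_iff using n_pos(1) by linarith
  then have "s \<in> int ` line_sums ?N A" using sub by (rule subsetD[rotated])
  then have s0: "0 \<le> s" by (elim imageE) simp
  have lines: "line_sums ?N A = {nat s..<nat s + (2 * ?N + 2)}"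
  proof (rule card_seteq[symmetric])
    show "finite (line_sums ?N A)" by (simp add: line_sums_def)
    show "{nat s..<nat s + (2 * ?N + 2)} \<subseteq> line_sums ?N A"
    proof
      fix x assume "x \<in> {nat s..<nat s + (2 * ?N + 2)}"
      moreover have "int ?N = n" by simp
      ultimately have "int x \<in> {s..<s + 2 * n + 2}"
        using s0 unfolding atLeastLessThan_iff by linarith
      then show "x \<in> line_sums ?N A" using sub by auto
    qed
    show "card (line_sums ?N A) \<le> card {nat s..<nat s + (2 * ?N + 2)}"
      using card_line_sums_le by simp
  qed
  have range: "A i j \<in> {0..?N * ?d}" for i j
  proof -
    have "int (A i j) \<le> int (?N * ?d)" using cell_range(1)[OF fill] by (simp add: intA)
    then show ?thesis unfolding of_nat_le_iff by simp
  qed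
  have unique: "\<exists>!p. p \<in> {1..?N} \<times> {1..?N} \<and> A (fst p) (snd p) = k" if k: "k \<in> {1..?N * ?d}" for k
  proof -
    have "int k \<le> int (?N * ?d)" using k by (simp only: of_nat_le_iff atLeastAtMost_iff)
    then have "int k \<in> {1..n * int ?d}" using k by simp
    then have "int k \<in> (\<lambda>(c, i). G c i) ` (C \<times> {0..<n})"
      using filling_bij[OF fill] by (simp only: bij_betw_def)
    then obtain c r where cr: "c \<in> C" "r \<in> {0..<n}" "G c r = int k" by auto
    obtain i where i: "i \<in> {1..?N}" "(int i - h) mod n = r mod n" using residue_exists by blast
    obtain j where j: "j \<in> {1..?N}" "(int j - h) mod n = (2 * (int i - h) + c) mod n"
      using residue_exists by blast
    have r: "r mod n = r" using cr(2) by simp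
    have "n dvd (int j - h - 2 * (int i - h) - c)"
      using j(2) by (simp add: mod_eq_dvd_iff algebra_simps)
    then have Aij: "A i j = k"
      using cell_eq[OF fill cr(1)] cr(3) i(2) r intA[of i j] by simp
    have only: "i' = i \<and> j' = j" if *: "i' \<in> {1..?N}" "j' \<in> {1..?N}" "A i' j' = k" for i' j'
    proof -
      have pos: "cell C G (int i' - h) (int j' - h) = int k" using *(3) intA by metis
      show ?thesis
      proof (cases rule: cell_cases[OF fill, of "int j' - h" "int i' - h"])
        case (1 c')
        have "c' = c \<and> (int i' - h) mod n = r"
          using filling_inj[OF fill 1(1) cr(1) mod_in_residues cr(2)] 1(3) pos cr(3) by simp
        then have i': "i' = i" and c': "c' = c"
          using inj_onD[OF bij_betw_imp_inj_on[OF bij_residue] _ *(1) i(1)] i(2) r by simp_all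
        have "(int j' - h) mod n = (2 * (int i' - h) + c') mod n"
          by (rule mod_eqI) (use 1(2) in \<open>simp add: algebra_simps\<close>)
        then have "j' = j"
          using inj_onD[OF bij_betw_imp_inj_on[OF bij_residue] _ *(2) j(1)] j(2) i' c' by simp
        with i' show ?thesis by simp
      next
        case 2
        then show ?thesis using pos k by simp
      qed
    qed
    show ?thesis
    proof (rule ex1I[of _ "(i, j)"])
      show "(i, j) \<in> {1..?N} \<times> {1..?N} \<and> A (fst (i, j)) (snd (i, j)) = k"
        using i(1) j(1) Aij by simp
      show "p = (i, j)" if "p \<in> {1..?N} \<times> {1..?N} \<and> A (fst p) (snd p) = k" for p
        using only[of "fst p" "snd p"] that unfolding mem_Times_iff by (simp add: prod_eq_iff)
    qed
  qed
  have "sams ?N ?d A"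
    unfolding sams_def
  proof (intro conjI ballI)
    show "?d < ?N" using assms(3) by linarith
    show "\<exists>s. line_sums ?N A = {s..<s + (2 * ?N + 2)}" using lines by blast
  qed (use assms(2) range unique in blast)+
  moreover have "card {j \<in> {1..?N}. 0 < A i j} = ?d" for i
    using posA[of "\<lambda>_. i" "\<lambda>j. j"] unfolding sum_cell_row[OF fin] by (simp add: row_def)
  moreover have "card {i \<in> {1..?N}. 0 < A i j} = ?d" for j
    using posA[of "\<lambda>i. i" "\<lambda>_. j"] unfolding sum_cell_col[OF fin] by (simp add: col_def)
  moreover have "card {i \<in> {1..?N}. 0 < A i i} = ?d"
    using posA[of "\<lambda>i. i" "\<lambda>i. i"] unfolding sum_cell_ldiag[OF fin] by (simp add: ldiag_def)
  moreover have "card {i \<in> {1..?N}. 0 < A i (?N + 1 - i)} = ?d"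
  proof -
    have "int (card {i \<in> {1..?N}. 0 < A i (?N + 1 - i)}) = rdiag C (\<lambda>_ _. 1)"
      unfolding posA sum_cell_rdiag[OF fin, symmetric]
      by (intro sum.cong refl) (simp only: refl_idx)
    then show ?thesis by (simp add: rdiag_def)
  qed
  ultimately show ?thesis unfolding regular_sams_def by blast
qed

subsection \<open>Fills with equal line sums\<close>

definition semimagic :: "int set \<Rightarrow> (int \<Rightarrow> int \<Rightarrow> int) \<Rightarrow> int \<Rightarrow> bool" where
  "semimagic C G s \<longleftrightarrow> filling C G \<and> (\<forall>i. row C G i = s) \<and> (\<forall>u. col C G u = s)"

definition magic :: "int set \<Rightarrow> (int \<Rightarrow> int \<Rightarrow> int) \<Rightarrow> int \<Rightarrow> bool" where
  "magic C G s \<longleftrightarrow> semimagic C G s \<and> ldiag C G = s \<and> rdiag C G = s"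

definition apart :: "int set \<Rightarrow> int set \<Rightarrow> bool" where
  "apart C D \<longleftrightarrow> (\<forall>c\<in>C. \<forall>c'\<in>D. \<not> n dvd (c - c'))"

text \<open>The labels up to \<open>n * card C\<close> are used up by \<open>G\<close>, hence the
  shift of \<open>F\<close>. Each line meets every transversal of \<open>D\<close> once, so the
  shift adds the same constant to all line sums.\<close>

definition join :: "int set \<Rightarrow> (int \<Rightarrow> int \<Rightarrow> int) \<Rightarrow> (int \<Rightarrow> int \<Rightarrow> int) \<Rightarrow> int \<Rightarrow> int \<Rightarrow> int" where
  "join C G F = (\<lambda>c i. if c \<in> C then G c i else F c i + n * int (card C))"

lemma apart_disjoint: "apart C D \<Longrightarrow> C \<inter> D = {}"
  unfolding apart_def by fastforce

lemma inj_mod_un: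
  assumes "inj_on (\<lambda>c. c mod n) C" "inj_on (\<lambda>c. c mod n) D" "apart C D"
  shows "inj_on (\<lambda>c. c mod n) (C \<union> D)"
proof (rule inj_onI)
  fix c c' assume *: "c \<in> C \<union> D" "c' \<in> C \<union> D" "c mod n = c' mod n"
  then have "n dvd (c - c')" "n dvd (c' - c)" by (simp_all add: mod_eq_dvd_iff[symmetric])
  then show "c = c'" using * assms unfolding apart_def inj_on_def by blast
qed

lemma sum_join:
  assumes "finite C" "finite D" "apart C D"
  shows "(\<Sum>c\<in>C \<union> D. join C G F c (k c))
    = (\<Sum>c\<in>C. G c (k c)) + ((\<Sum>c\<in>D. F c (k c)) + n * int (card C) * int (card D))"
proof -
  have "(\<Sum>c\<in>D. join C G F c (k c)) = (\<Sum>c\<in>D. F c (k c) + n * int (card C))"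
    using apart_disjoint[OF assms(3)] by (intro sum.cong) (auto simp: join_def)
  moreover have "(\<Sum>c\<in>C. join C G F c (k c)) = (\<Sum>c\<in>C. G c (k c))"
    by (simp add: join_def)
  ultimately show ?thesis
    using apart_disjoint[OF assms(3)] assms(1,2)
    by (simp add: sum.union_disjoint sum.distrib)
qed

lemma filling_join:
  assumes "filling C G" "filling D F" "apart C D"
  shows "filling (C \<union> D) (join C G F)"
proof -
  have fin: "finite C" "finite D" using assms by (auto simp: filling_def)
  have card: "card (C \<union> D) = card C + card D"
    using fin apart_disjoint[OF assms(3)] by (rule card_Un_disjoint)
  have "k \<in> (\<lambda>(c, i). join C G F c i) ` ((C \<union> D) \<times> {0..<n})"
    if k: "k \<in> {1..n * int (card C) + n * int (card D)}" for k
  proof (cases "k \<le> n * int (card C)")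
    case True
    then have "k \<in> {1..n * int (card C)}" using k by simp
    then have "k \<in> (\<lambda>(c, i). G c i) ` (C \<times> {0..<n})"
      using assms(1) unfolding filling_def by blast
    then show ?thesis by (force simp: join_def)
  next
    case False
    then have "k - n * int (card C) \<in> {1..n * int (card D)}" using k by simp
    then have "k - n * int (card C) \<in> (\<lambda>(c, i). F c i) ` (D \<times> {0..<n})"
      using assms(2) unfolding filling_def by blast
    then obtain c i where c: "c \<in> D" "i \<in> {0..<n}" "k = F c i + n * int (card C)" by auto
    then have "k = join C G F c i"
      using apart_disjoint[OF assms(3)] by (auto simp: join_def)
    then show ?thesis using c(1,2) by force
  qed
  then show ?thesis
    using assms fin inj_mod_un[of C D] by (auto simp: filling_def card distrib_left)
qed

lemma line_join:
  assumes "filling C G" "filling D F" "apart C D"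
  defines "b \<equiv> n * int (card C) * int (card D)"
  shows "row (C \<union> D) (join C G F) i = row C G i + (row D F i + b)"
    and "col (C \<union> D) (join C G F) u = col C G u + (col D F u + b)"
    and "ldiag (C \<union> D) (join C G F) = ldiag C G + (ldiag D F + b)"
    and "rdiag (C \<union> D) (join C G F) = rdiag C G + (rdiag D F + b)"
  unfolding row_def col_def ldiag_def rdiag_def b_def
  using assms(1-3) by (auto intro!: sum_join simp: filling_def)

lemma semimagic_join:
  assumes "semimagic C G s" "semimagic D F s'" "apart C D"
  shows "semimagic (C \<union> D) (join C G F) (s + (s' + n * int (card C) * int (card D)))"
  using assms by (simp add: semimagic_def filling_join line_join)

lemma magic_join:
  assumes "magic C G s" "magic D F s'" "apart C D"
  shows "magic (C \<union> D) (join C G F) (s + (s' + n * int (card C) * int (card D)))"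
  using assms semimagic_join[of C G s D F s'] unfolding magic_def
  by (simp add: semimagic_def line_join)

lemma antimagic_join:
  assumes "antimagic C G" "magic D F s'" "apart C D"
  shows "antimagic (C \<union> D) (join C G F)"
proof -
  let ?b = "s' + n * int (card C) * int (card D)"
  let ?L = "row C G ` {0..<n} \<union> col C G ` {0..<n} \<union> {ldiag C G, rdiag C G}"
  have fill: "filling C G" "filling D F"
    using assms by (auto simp: antimagic_def magic_def semimagic_def)
  have lines: "row (C \<union> D) (join C G F) = (\<lambda>i. row C G i + ?b)"
    "col (C \<union> D) (join C G F) = (\<lambda>i. col C G i + ?b)"
    "ldiag (C \<union> D) (join C G F) = ldiag C G + ?b"
    "rdiag (C \<union> D) (join C G F) = rdiag C G + ?b"
    using line_join[OF fill assms(3)] assms(2) by (auto simp: magic_def semimagic_def)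
  obtain s where "{s..<s + 2 * n + 2} \<subseteq> ?L" using assms(1) by (auto simp: antimagic_def)
  then have "(\<lambda>v. v + ?b) ` {s..<s + 2 * n + 2} \<subseteq> (\<lambda>v. v + ?b) ` ?L" by (rule image_mono)
  then have "{s + ?b..<(s + ?b) + 2 * n + 2} \<subseteq> (\<lambda>v. v + ?b) ` ?L"
    by (simp add: image_add_atLeastLessThan' algebra_simps)
  then show ?thesis
    unfolding antimagic_def lines using filling_join[OF fill assms(3)]
    by (simp only: image_Un image_insert image_image image_empty) blast
qed

text \<open>The two residues add up to a number between \<open>0\<close> and
  \<open>2 * n - 2\<close> that is congruent to \<open>- 1\<close>, and \<open>n - 1\<close> is the
  only one. This turns antisymmetry modulo \<open>n\<close> into an exact identity between
  labels.\<close>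

lemma reflect_residues:
  assumes "n dvd (a + b + 1)"
  shows "a mod n + b mod n = n - 1"
proof -
  have "b mod n = (- 1 - a mod n) mod n"
    using assms dvd_mod_iff[of "b + 1" 1 a] by (intro mod_eqI) (simp add: algebra_simps)
  also have "\<dots> = n - 1 - a mod n"
  proof -
    have "(- 1 - a mod n) mod n = (n - 1 - a mod n) mod n" by (rule mod_eqI) simp
    also have "\<dots> = n - 1 - a mod n"
      using mod_in_residues[of a] unfolding atLeastLessThan_iff
      by (intro mod_pos_pos_trivial) linarith+
    finally show ?thesis .
  qed
  finally show ?thesis by simp
qed

lemma residue_solve:
  assumes "n dvd (x * y - 1)" "r \<in> {0..<n}"
  shows "\<exists>i\<in>{0..<n}. (y * i + e) mod n = r"
proof
  have "(y * ((x * (r - e)) mod n) + e) mod n = (y * (x * (r - e)) + e) mod n"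
    by (metis mod_add_left_eq mod_mult_right_eq)
  also have "\<dots> = r mod n"
    using assms(1) by (intro mod_eqI) (rule dvd_combine[where a = 0 and b = "r - e"], auto simp: algebra_simps)
  finally show "(y * ((x * (r - e)) mod n) + e) mod n = r" using assms(2) by simp
qed (rule mod_in_residues)

text \<open>
  The complement of the array rotated by 180 degrees has the opposite deviations on both
  diagonals, because a rotation by 180 degrees maps each diagonal to itself.
\<close>

lemma magic_rotate:
  assumes "semimagic C G s" "apart C (uminus ` C)"
  shows "\<exists>F s'. magic (C \<union> uminus ` C) F s'"
proof -
  let ?d = "int (card C)"
  define R where "R c i = n * ?d + 1 - G (- c) ((- i) mod n)" for c i
  have fill: "filling C G" and fin: "finite C" using assms by (auto simp: semimagic_def filling_def)
  have card: "card (uminus ` C) = card C" by (simp add: card_image)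
  have neg: "(\<Sum>c\<in>uminus ` C. R c (k c)) = ?d * (n * ?d + 1) - (\<Sum>c\<in>C. G c ((- k (- c)) mod n))" for k
    by (subst sum.reindex) (auto simp: R_def sum_subtractf)
  have inj: "inj_on (\<lambda>c. c mod n) (uminus ` C)"
  proof (rule inj_onI, clarify)
    fix c c' assume *: "c \<in> C" "c' \<in> C" "- c mod n = - c' mod n"
    then have "c mod n = c' mod n" by (metis minus_minus mod_minus_eq)
    with * fill show "- c = - c'" by (auto simp: filling_def inj_on_def)
  qed
  have "k \<in> (\<lambda>(c, i). R c i) ` (uminus ` C \<times> {0..<n})" if k: "k \<in> {1..n * ?d}" for k
  proof -
    have "n * ?d + 1 - k \<in> {1..n * ?d}" using k by auto
    then have "n * ?d + 1 - k \<in> (\<lambda>(c, i). G c i) ` (C \<times> {0..<n})"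
      using fill unfolding filling_def by blast
    then obtain c i where c: "c \<in> C" "i \<in> {0..<n}" "n * ?d + 1 - k = G c i" by auto
    then have "R (- c) ((- i) mod n) = k" by (simp add: R_def mod_simps)
    then show ?thesis using c(1) mod_in_residues[of "- i"] by (metis (no_types, lifting) SigmaI case_prod_conv image_eqI)
  qed
  then have fillR: "filling (uminus ` C) R"
    using fin inj by (auto simp: filling_def card)
  have "row (uminus ` C) R i = ?d * (n * ?d + 1) - row C G (- i)" for i
    unfolding row_def neg by (simp add: mod_simps)
  moreover have "col (uminus ` C) R u = ?d * (n * ?d + 1) - col C G (- u)" for u
    unfolding col_def neg by (simp add: mod_simps)
  ultimately have semR: "semimagic (uminus ` C) R (?d * (n * ?d + 1) - s)"
    using fillR assms(1) by (simp add: semimagic_def)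
  have "ldiag (uminus ` C) R = ?d * (n * ?d + 1) - ldiag C G"
    "rdiag (uminus ` C) R = ?d * (n * ?d + 1) - rdiag C G"
    unfolding ldiag_def rdiag_def neg by (simp_all add: mod_simps)
  then have "magic (C \<union> uminus ` C) (join C G R)
      (s + (?d * (n * ?d + 1) - s + n * int (card C) * int (card (uminus ` C))))"
    using semimagic_join[OF assms(1) semR assms(2)] line_join[OF fill fillR assms(2)]
    unfolding magic_def by (simp add: card)
  then show ?thesis by blast
qed

lemma fillingI:
  assumes "finite C" "inj_on (\<lambda>c. c mod n) C"
    and "\<And>k. 1 \<le> k \<Longrightarrow> k \<le> n * int (card C) \<Longrightarrow> \<exists>c\<in>C. \<exists>i\<in>{0..<n}. G c i = k"
  shows "filling C G"
  unfolding filling_def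
proof (intro conjI assms(1,2) subsetI)
  fix k assume "k \<in> {1..n * int (card C)}"
  then obtain c i where "c \<in> C" "i \<in> {0..<n}" "G c i = k"
    using assms(3)[of k] by auto
  then show "k \<in> (\<lambda>(c, i). G c i) ` (C \<times> {0..<n})" by (intro image_eqI[of _ _ "(c, i)"]) auto
qed

text \<open>
  With \<open>a = - (x + y) / 2\<close> the classes carry \<open>f i\<close>, \<open>- f i\<close>, \<open>f (i + a)\<close>, \<open>- f (i + a)\<close> up to
  constants. This cancels in rows, the shift by \<open>a\<close> makes it cancel in columns, and
  \<open>f (a - i) = - f i\<close> makes it cancel on the diagonals.
\<close>

lemma magic_block:
  assumes xy: "x \<in> {1..m}" "y \<in> {1..m}" "x \<noteq> y"
  shows "\<exists>G s. magic {x, y, - x, - y} G s"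
proof -
  define a where "a = - h * (x + y)"
  \<comment> \<open>The offset solves \<open>a + 2 * e + 1 = 0\<close> modulo \<open>n\<close>,
    which is the symmetry \<open>f (a - i) = - f i\<close> of the centred residue of
    \<open>i + e\<close>.\<close>
  define e where "e = h * (- 1 - a)"
  define G where "G c i = (if c = x then 1 + (i + e) mod n else if c = y then 2 * n - (i + e) mod n
    else if c = - x then 2 * n + 1 + (i + (a + e)) mod n else 4 * n - (i + (a + e)) mod n)" for c i
  have ne: "y \<noteq> x" "x \<noteq> y" "- x \<noteq> x" "x \<noteq> - x" "- y \<noteq> x" "x \<noteq> - y" "- x \<noteq> y" "y \<noteq> - x"
    "- y \<noteq> y" "y \<noteq> - y" "- y \<noteq> - x" "- x \<noteq> - y"
    using xy by auto
  have G: "G x i = 1 + (i + e) mod n" "G y i = 2 * n - (i + e) mod n"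
    "G (- x) i = 2 * n + 1 + (i + (a + e)) mod n" "G (- y) i = 4 * n - (i + (a + e)) mod n" for i
    unfolding G_def using ne by (simp_all only: if_True if_False refl)
  have sum: "(\<Sum>c\<in>{x, y, - x, - y}. f c) = f x + f y + f (- x) + f (- y)" for f :: "int \<Rightarrow> int"
    using xy by auto
  have card: "card {x, y, - x, - y} = 4" using xy by (auto simp: card_insert_if)
  have inj: "inj_on (\<lambda>c. c mod n) {x, y, - x, - y}"
  proof (rule inj_onI)
    fix c c' assume *: "c \<in> {x, y, - x, - y}" "c' \<in> {x, y, - x, - y}" "c mod n = c' mod n"
    then have "n dvd (c - c')" by (simp add: mod_eq_dvd_iff)
    moreover have "\<bar>c - c'\<bar> < n" using *(1,2) xy n_def by auto
    ultimately show "c = c'" using zdvd_imp_le[of n "\<bar>c - c'\<bar>"] by force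
  qed
  have solve: "\<exists>i\<in>{0..<n}. (i + b) mod n = r" if "r \<in> {0..<n}" for r b
    using residue_solve[of 1 1 r b] that by simp
  have "filling {x, y, - x, - y} G"
  proof (rule fillingI[OF _ inj])
    fix k assume "1 \<le> k" "k \<le> n * int (card {x, y, - x, - y})"
    then have k: "1 \<le> k" "k \<le> 4 * n" unfolding card by simp_all
    consider "k \<le> n" | "n < k" "k \<le> 2 * n" | "2 * n < k" "k \<le> 3 * n" | "3 * n < k" by linarith
    then show "\<exists>c\<in>{x, y, - x, - y}. \<exists>i\<in>{0..<n}. G c i = k"
    proof cases
      case 1
      then obtain i where "i \<in> {0..<n}" "(i + e) mod n = k - 1" using solve[of "k - 1" e] k by auto
      then have "G x i = k" unfolding G by simp
      then show ?thesis using \<open>i \<in> {0..<n}\<close> by blast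
    next
      case 2
      then obtain i where "i \<in> {0..<n}" "(i + e) mod n = 2 * n - k"
        using solve[of "2 * n - k" e] by auto
      then have "G y i = k" unfolding G by simp
      then show ?thesis using \<open>i \<in> {0..<n}\<close> by blast
    next
      case 3
      then obtain i where "i \<in> {0..<n}" "(i + (a + e)) mod n = k - 1 - 2 * n"
        using solve[of "k - 1 - 2 * n" "a + e"] by auto
      then have "G (- x) i = k" unfolding G by simp
      then show ?thesis using \<open>i \<in> {0..<n}\<close> by blast
    next
      case 4
      then obtain i where "i \<in> {0..<n}" "(i + (a + e)) mod n = 4 * n - k"
        using solve[of "4 * n - k" "a + e"] k by auto
      then have "G (- y) i = k" unfolding G by simp
      then show ?thesis using \<open>i \<in> {0..<n}\<close> by blast
    qed
  qed simp
  moreover have "row {x, y, - x, - y} G i = 8 * n + 2" for i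
    unfolding row_def sum G by simp
  moreover have "col {x, y, - x, - y} G u = 8 * n + 2" for u
  proof -
    \<comment> \<open>In a column, class \<open>x\<close> cancels against \<open>- y\<close>, and
      \<open>y\<close> against \<open>- x\<close>; this determines \<open>a\<close>.\<close>
    have "u - h * x + e = u - h * (- y) + (a + e)" "u - h * y + e = u - h * (- x) + (a + e)"
      unfolding a_def by algebra+
    then have "(u - h * x + e) mod n = (u - h * (- y) + (a + e)) mod n"
      "(u - h * y + e) mod n = (u - h * (- x) + (a + e)) mod n"
      by (simp_all only:)
    then show ?thesis unfolding col_def sum G by (simp add: mod_simps)
  qed
  \<comment> \<open>\<open>w = 1\<close> is the left diagonal and \<open>w = t\<close> the right
    one. Here class \<open>x\<close> is balanced by \<open>- x\<close>, and \<open>y\<close> by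
    \<open>- y\<close>.\<close>
  moreover have diag: "(- w * x + e) mod n + (- w * (- x) + (a + e)) mod n = n - 1"
    "(- w * y + e) mod n + (- w * (- y) + (a + e)) mod n = n - 1" for w
  proof -
    have "a + 2 * e + 1 = n * (- 1 - a)" unfolding e_def using two_h by algebra
    then have "n dvd (a + 2 * e + 1)" by simp
    then show "(- w * x + e) mod n + (- w * (- x) + (a + e)) mod n = n - 1"
      "(- w * y + e) mod n + (- w * (- y) + (a + e)) mod n = n - 1"
      by (intro reflect_residues; simp add: algebra_simps)+
  qed
  moreover have "ldiag {x, y, - x, - y} G = 8 * n + 2"
    using diag[of 1] unfolding ldiag_def sum G by (simp add: mod_simps)
  moreover have "rdiag {x, y, - x, - y} G = 8 * n + 2"
    using diag[of t] unfolding rdiag_def sum G by (simp add: mod_simps)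
  ultimately show ?thesis unfolding magic_def semimagic_def by blast
qed

lemma small_not_dvd: "\<bar>c\<bar> < n \<Longrightarrow> c \<noteq> 0 \<Longrightarrow> \<not> n dvd c"
  using zdvd_imp_le[of n "\<bar>c\<bar>"] by auto

lemma magic_blocks:
  assumes "P \<subseteq> {1..m}" "card P = 2 * k"
  shows "\<exists>G s. magic (P \<union> uminus ` P) G s"
  using assms
proof (induction k arbitrary: P)
  case 0
  then have "P = {}" using finite_subset[of P "{1..m}"] by simp
  then show ?case
    by (auto simp: magic_def semimagic_def filling_def row_def col_def ldiag_def rdiag_def)
next
  case (Suc k)
  then obtain x P' where x: "P = insert x P'" "x \<notin> P'" "card P' = Suc (2 * k)"
    by (auto simp: card_Suc_eq dest!: card_eq_SucD)
  then obtain y Q where y: "P' = insert y Q" "y \<notin> Q" "card Q = 2 * k"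
    by (auto dest!: card_eq_SucD)
  have "Q \<subseteq> {1..m}" using Suc.prems x y by auto
  then obtain G s where G: "magic (Q \<union> uminus ` Q) G s" using Suc.IH y(3) by blast
  have "x \<in> {1..m}" "y \<in> {1..m}" "x \<noteq> y" using Suc.prems x y by auto
  then obtain F s' where F: "magic {x, y, - x, - y} F s'" using magic_block by blast
  have "apart (Q \<union> uminus ` Q) {x, y, - x, - y}"
    unfolding apart_def
  proof (intro ballI)
    fix c c' assume "c \<in> Q \<union> uminus ` Q" "c' \<in> {x, y, - x, - y}"
    then show "\<not> n dvd (c - c')"
      using \<open>Q \<subseteq> {1..m}\<close> \<open>x \<in> {1..m}\<close> \<open>y \<in> {1..m}\<close> x y n_def
      by (intro small_not_dvd) (auto simp: subset_iff)
  qed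
  from magic_join[OF G F this] obtain H s'' where
    "magic (Q \<union> uminus ` Q \<union> {x, y, - x, - y}) H s''" by blast
  moreover have "Q \<union> uminus ` Q \<union> {x, y, - x, - y} = P \<union> uminus ` P"
    using x y by auto
  ultimately show ?case by auto
qed

text \<open>Modulo \<open>n\<close>, \<open>a\<close> is \<open>c / 2\<close> and \<open>b\<close>
  is \<open>(c - 1) / 2\<close>. Exactly one of the two halvings wraps around, so as integers they
  add up to \<open>m + c mod n\<close>. Together with the complement of \<open>c\<close> this yields
  three permutations of the residues with constant sum (a Kotzig array with three rows), which is
  what balances an odd number of classes.\<close>

lemma half_residues:
  assumes "n dvd (2 * a - c)" "n dvd (b - a + h)"
  shows "a mod n + b mod n = m + c mod n"
proof -
  let ?a = "a mod n"
  have a: "0 \<le> ?a" "?a < n" by simp_all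
  have c: "c mod n = (2 * ?a) mod n"
    using assms(1) dvd_mod_iff[of "- c" 2 a]
    by (intro mod_eqI[symmetric]) (simp add: algebra_simps)
  have b: "b mod n = (?a - h) mod n"
    using assms(2) dvd_mod_iff[of "b + h" "- 1" a] by (intro mod_eqI) (simp add: algebra_simps)
  show ?thesis
  proof (cases "?a \<le> m")
    case True
    have "?a - h - (?a + m) = n * (- 1)" by (simp add: n_def h_def)
    then have "(?a - h) mod n = (?a + m) mod n" by (metis dvd_triv_left mod_eqI)
    also have "\<dots> = ?a + m" using True a n_def by (intro mod_pos_pos_trivial) auto
    finally show ?thesis using b c True a n_def by (simp add: mod_pos_pos_trivial)
  next
    case False
    have "(2 * ?a) mod n = (2 * ?a - n) mod n" by (rule mod_eqI) simp
    also have "\<dots> = 2 * ?a - n" using False a n_def by (intro mod_pos_pos_trivial) auto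
    finally show ?thesis using b c False a n_def h_def by (simp add: mod_pos_pos_trivial)
  qed
qed

text \<open>After multiplication by \<open>y = 1 / x\<close>, passing from a row to a column
  displaces the arguments of classes \<open>c + x\<close> and \<open>c - x\<close> by
  \<open>- 1 / 2\<close> and \<open>1 / 2\<close>. Their offsets differ by \<open>1 / 2\<close>, so
  rows and columns both show the pair of \<open>half_residues\<close>, with the roles exchanged. For
  \<open>c = 0\<close> the outer classes meet each diagonal in opposite rows, and the middle class
  contributes its middle label.\<close>

lemma triple_exists:
  assumes inj: "inj_on (\<lambda>c. c mod n) {c + x, c - x, c}" and x: "x \<noteq> 0" and y: "n dvd (x * y - 1)"
  shows "\<exists>G s. semimagic {c + x, c - x, c} G s \<and> (c = 0 \<longrightarrow> magic {c + x, c - x, c} G s)"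
proof -
  \<comment> \<open>\<open>m\<close> is twice \<open>h * m\<close> modulo \<open>n\<close>, as
    \<open>half_residues\<close> requires. The first two offsets add up to \<open>- 1\<close> modulo
    \<open>n\<close>, so that \<open>reflect_residues\<close> applies on the diagonals when
    \<open>c = 0\<close>.\<close>
  define G where "G d i = (if d = c + x then 1 + (y * i + h * m) mod n
    else if d = c - x then 1 + n + (y * i + (h * m - h)) mod n
    else 3 * n - (2 * y * i + m) mod n)" for d i
  have G: "G (c + x) i = 1 + (y * i + h * m) mod n"
    "G (c - x) i = 1 + n + (y * i + (h * m - h)) mod n"
    "G c i = 3 * n - (2 * y * i + m) mod n" for i
    using x by (simp_all add: G_def)
  have sum: "(\<Sum>d\<in>{c + x, c - x, c}. f d) = f (c + x) + f (c - x) + f c" for f :: "int \<Rightarrow> int"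
    using x by simp
  have card: "card {c + x, c - x, c} = 3" using x by simp
  have mod: "(y * (i mod n) + b) mod n = (y * i + b) mod n" for i y b
    by (metis mod_add_left_eq mod_mult_right_eq)
  have "n dvd (h * x * (2 * y) - 1)"
    by (rule dvd_combine[OF y, where a = "x * y" and b = 1]) (use two_h in algebra)
  note solve = residue_solve[OF y] residue_solve[OF this]
  have "filling {c + x, c - x, c} G"
  proof (rule fillingI[OF _ inj])
    fix k assume "1 \<le> k" "k \<le> n * int (card {c + x, c - x, c})"
    then have k: "1 \<le> k" "k \<le> 3 * n" unfolding card by simp_all
    consider "k \<le> n" | "n < k" "k \<le> 2 * n" | "2 * n < k" by linarith
    then show "\<exists>d\<in>{c + x, c - x, c}. \<exists>i\<in>{0..<n}. G d i = k"
    proof cases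
      case 1
      then obtain i where "i \<in> {0..<n}" "(y * i + h * m) mod n = k - 1"
        using solve(1)[of "k - 1" "h * m"] k by auto
      then have "G (c + x) i = k" unfolding G by simp
      then show ?thesis using \<open>i \<in> {0..<n}\<close> by blast
    next
      case 2
      then obtain i where "i \<in> {0..<n}" "(y * i + (h * m - h)) mod n = k - 1 - n"
        using solve(1)[of "k - 1 - n" "h * m - h"] by auto
      then have "G (c - x) i = k" unfolding G by simp
      then show ?thesis using \<open>i \<in> {0..<n}\<close> by blast
    next
      case 3
      then obtain i where "i \<in> {0..<n}" "(2 * y * i + m) mod n = 3 * n - k"
        using solve(2)[of "3 * n - k" m] k by auto
      then have "G c i = k" unfolding G by simp
      then show ?thesis using \<open>i \<in> {0..<n}\<close> by blast
    qed
  qed simp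
  moreover have "row {c + x, c - x, c} G i = m + 4 * n + 2" for i
  proof -
    have "(y * i + h * m) mod n + (y * i + (h * m - h)) mod n = m + (2 * y * i + m) mod n"
      by (rule half_residues, rule dvd_combine[OF y, where a = m and b = 0])
        (use two_h in algebra, simp)
    then show ?thesis unfolding row_def sum G mod by simp
  qed
  moreover have "col {c + x, c - x, c} G u = m + 4 * n + 2" for u
  proof -
    have "(y * (u - h * (c - x)) + (h * m - h)) mod n + (y * (u - h * (c + x)) + h * m) mod n
        = m + (2 * y * (u - h * c) + m) mod n"
      by (rule half_residues, rule dvd_combine[OF y, where a = "x * y + m - 1" and b = 1],
          use two_h in algebra, rule dvd_combine[OF y, where a = "1 - x * y" and b = "- 1"],
          use two_h in algebra)
    then show ?thesis unfolding col_def sum G mod by simp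
  qed
  moreover have "magic {c + x, c - x, c} G (m + 4 * n + 2)"
    if "semimagic {c + x, c - x, c} G (m + 4 * n + 2)" "c = 0"
  proof -
    have refl: "(y * v + h * m) mod n + (y * (- v) + (h * m - h)) mod n = n - 1" for v
    proof (rule reflect_residues)
      have "y * v + h * m + (y * (- v) + (h * m - h)) + 1 = n * m"
        using two_h h_def by algebra
      then show "n dvd (y * v + h * m + (y * (- v) + (h * m - h)) + 1)" by simp
    qed
    have zero: "- (c - x) = - (- (c + x))" "- t * (c - x) = - (- t * (c + x))"
      "2 * y * - c = 0" "2 * y * (- t * c) = 0"
      using that(2) by simp_all
    have "(0 + m) mod n = m" using m_ge_2 n_def by simp
    then have "ldiag {c + x, c - x, c} G = m + 4 * n + 2"
      "rdiag {c + x, c - x, c} G = m + 4 * n + 2"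
      unfolding ldiag_def rdiag_def sum G mod zero
      using refl[of "- (c + x)"] refl[of "- t * (c + x)"] n_def by linarith+
    then show ?thesis using that(1) by (simp add: magic_def)
  qed
  ultimately show ?thesis unfolding semimagic_def by blast
qed

lemma mod_shift: "a = b + n * k \<Longrightarrow> a mod n = b mod n"
  by simp

subsection \<open>Density two\<close>

lemma antimagicI:
  assumes "filling C G"
    and "\<And>v. s \<le> v \<Longrightarrow> v \<le> s + 2 * n + 1 \<Longrightarrow>
      (\<exists>i. row C G i = v) \<or> (\<exists>u. col C G u = v) \<or> v = ldiag C G \<or> v = rdiag C G"
  shows "antimagic C G"
proof -
  have row: "row C G i = row C G (i mod n)" for i by (simp add: row_def)
  have col: "col C G u = col C G (u mod n)" for u by (simp add: col_def mod_simps)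
  have "v \<in> row C G ` {0..<n} \<union> col C G ` {0..<n} \<union> {ldiag C G, rdiag C G}"
    if "v \<in> {s..<s + 2 * n + 2}" for v
  proof -
    have "s \<le> v" "v \<le> s + 2 * n + 1" using that by simp_all
    then consider i where "row C G i = v" | u where "col C G u = v" | "v \<in> {ldiag C G, rdiag C G}"
      using assms(2) by blast
    then show ?thesis
    proof cases
      case 1
      then show ?thesis using row mod_in_residues by blast
    next
      case 2
      then show ?thesis using col mod_in_residues by blast
    qed blast
  qed
  then show ?thesis using assms(1) unfolding antimagic_def by blast
qed

text \<open>
  Two classes form a cycle of \<open>2 * n\<close> cells in which consecutive cells share a row or a column;
  each diagonal joins one further pair of cells.
\<close>

lemma antimagic_two:
  fixes a b :: "int \<Rightarrow> int"
  assumes fill: "\<And>k. 1 \<le> k \<Longrightarrow> k \<le> 2 * n \<Longrightarrow> \<exists>i\<in>{0..<n}. a i = k \<or> b i = k"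
    and hit: "\<And>v. s \<le> v \<Longrightarrow> v \<le> s + 2 * n + 1 \<Longrightarrow>
      (\<exists>i\<in>{0..<n}. a i + b i = v) \<or> (\<exists>i\<in>{0..<n}. a i + b ((i + 1) mod n) = v) \<or>
      v = a (2 * m) + b 1 \<or> v = a ((- t) mod n) + b (t mod n)"
  shows "\<exists>G. antimagic {1, - 1} G"
proof
  define G where "G c i = (if c = 1 then a i else b i)" for c i :: int
  have G: "G 1 = a" "G (- 1) = b" by (simp_all add: G_def fun_eq_iff)
  have sum: "(\<Sum>c\<in>{1, - 1 :: int}. f c) = f 1 + f (- 1)" for f :: "int \<Rightarrow> int" by simp
  have "(- 1) mod n = 2 * m"
  proof -
    have "(- 1) mod n = (2 * m) mod n" by (rule mod_shift[where k = "-1"]) (simp add: n_def)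
    then show ?thesis using m_ge_2 by (simp add: n_def)
  qed
  moreover have "1 mod n = 1" using m_ge_2 n_def by simp
  ultimately have diag: "ldiag {1, - 1} G = a (2 * m) + b 1"
    "rdiag {1, - 1} G = a ((- t) mod n) + b (t mod n)"
    unfolding ldiag_def rdiag_def sum G by simp_all
  have row: "row {1, - 1} G i = a i + b i" if "i \<in> {0..<n}" for i
    using that unfolding row_def sum G by simp
  have col: "col {1, - 1} G (i + h) = a i + b ((i + 1) mod n)" if "i \<in> {0..<n}" for i
  proof -
    have "(i + h - h * (- 1)) mod n = (i + 1) mod n"
      by (rule mod_shift[where k = 1]) (use two_h in simp)
    moreover have "(i + h - h * 1) mod n = i" using that by simp
    ultimately show ?thesis unfolding col_def sum G by simp
  qed
  have "filling {1, - 1} G"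
  proof (rule fillingI)
    show "inj_on (\<lambda>c. c mod n) {1, - 1}"
    proof (rule inj_onI)
      fix c c' assume *: "c \<in> {1, - 1 :: int}" "c' \<in> {1, - 1}" "c mod n = c' mod n"
      then have "n dvd (c - c')" by (simp add: mod_eq_dvd_iff)
      moreover have "\<bar>c - c'\<bar> < n" using *(1,2) m_ge_2 n_def by auto
      ultimately show "c = c'" using small_not_dvd[of "c - c'"] by auto
    qed
    show "\<exists>c\<in>{1, - 1}. \<exists>i\<in>{0..<n}. G c i = k"
      if "1 \<le> k" "k \<le> n * int (card {1, - 1 :: int})" for k
      using fill[of k] that by (auto simp: G)
  qed simp
  then show "antimagic {1, - 1} G"
  proof (rule antimagicI)
    fix v assume "s \<le> v" "v \<le> s + 2 * n + 1"
    then show "(\<exists>i. row {1, - 1} G i = v) \<or> (\<exists>u. col {1, - 1} G u = v) \<or>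
        v = ldiag {1, - 1} G \<or> v = rdiag {1, - 1} G"
      unfolding diag using hit[of v] row col by metis
  qed
qed

text \<open>Away from a few exceptional indices \<open>a\<close> and \<open>b\<close> both grow by
  \<open>1\<close>, so row sums step through even values and column sums through odd ones. Row
  \<open>m + 1\<close> supplies the odd maximum \<open>6 * m + 5\<close>. The even values
  \<open>4 * m + 4\<close> and \<open>6 * m + 4\<close> are missed and are the left and right
  diagonal sums.\<close>

lemma antimagic_two_5:
  assumes p: "m = 3 * p + 2" "t = 2 * p + 2"
  shows "\<exists>G. antimagic {1, - 1} G"
proof -
  define a where "a i = (if i < m then m + 3 + i else if i = m then 1
    else if i < 2 * m then m + 2 + i else m + 2)" for i
  define b where "b i = (if i = 0 then m + 1 else if i \<le> m then 3 * m + 1 + i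
    else if i = m + 1 then 4 * m + 2 else i - m)" for i
  have next_i: "(i + 1) mod n = (if i = 2 * m then 0 else i + 1)" if "0 \<le> i" "i \<le> 2 * m" for i
    using that by (auto simp: n_def)
  have p0: "0 \<le> p" using m_ge_2 p by simp
  have "(- t) mod n = (4 * p + 3) mod n" by (rule mod_shift[where k = "-1"]) (simp add: n_def p)
  then have tt: "(- t) mod n = 4 * p + 3" "t mod n = 2 * p + 2" using p0 by (simp_all add: n_def p)
  show ?thesis
  proof (rule antimagic_two[of a b "2 * m + 2"])
    fix k :: int assume "1 \<le> k" "k \<le> 2 * n"
    then have k: "1 \<le> k" "k \<le> 4 * m + 2" by (simp_all add: n_def)
    have *: "\<exists>i\<in>{0..<n}. a i = k \<or> b i = k" if "0 \<le> i" "i \<le> 2 * m" "a i = k \<or> b i = k" for i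
      using that by (intro bexI[of _ i]) (auto simp: n_def)
    consider "k \<le> 1" | "1 < k" "k \<le> m" | "m < k" "k \<le> m + 1" | "m + 1 < k" "k \<le> m + 2" | "m + 2 < k" "k \<le> 2 * m + 2" | "2 * m + 2 < k" "k \<le> 3 * m + 1" | "3 * m + 1 < k" "k \<le> 4 * m + 1" | "4 * m + 1 < k"
      by linarith
    then show "\<exists>i\<in>{0..<n}. a i = k \<or> b i = k"
    proof cases
      case 1
      show ?thesis by (rule *[of "m"]) (use 1 k m_ge_2 p in \<open>auto simp: a_def b_def\<close>)
    next
      case 2
      show ?thesis by (rule *[of "k + m"]) (use 2 k m_ge_2 p in \<open>auto simp: a_def b_def\<close>)
    next
      case 3
      show ?thesis by (rule *[of "0"]) (use 3 k m_ge_2 p in \<open>auto simp: a_def b_def\<close>)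
    next
      case 4
      show ?thesis by (rule *[of "2 * m"]) (use 4 k m_ge_2 p in \<open>auto simp: a_def b_def\<close>)
    next
      case 5
      show ?thesis by (rule *[of "k - m - 3"]) (use 5 k m_ge_2 p in \<open>auto simp: a_def b_def\<close>)
    next
      case 6
      show ?thesis by (rule *[of "k - m - 2"]) (use 6 k m_ge_2 p in \<open>auto simp: a_def b_def\<close>)
    next
      case 7
      show ?thesis by (rule *[of "k - 3 * m - 1"]) (use 7 k m_ge_2 p in \<open>auto simp: a_def b_def\<close>)
    next
      case 8
      show ?thesis by (rule *[of "m + 1"]) (use 8 k m_ge_2 p in \<open>auto simp: a_def b_def\<close>)
    qed
  next
    fix v assume "2 * m + 2 \<le> v" "v \<le> 2 * m + 2 + 2 * n + 1"
    then have v: "2 * m + 2 \<le> v" "v \<le> 6 * m + 5" by (simp_all add: n_def)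
    let ?hit = "(\<exists>i\<in>{0..<n}. a i + b i = v) \<or> (\<exists>i\<in>{0..<n}. a i + b ((i + 1) mod n) = v) \<or>
      v = a (2 * m) + b 1 \<or> v = a ((- t) mod n) + b (t mod n)"
    have row: ?hit if "0 \<le> i" "i \<le> 2 * m" "a i + b i = v" for i
      using that by (intro disjI1 bexI[of _ i]) (auto simp: n_def)
    have col: ?hit if "0 \<le> i" "i \<le> 2 * m" "a i + b (if i = 2 * m then 0 else i + 1) = v" for i
      using that by (intro disjI2 disjI1 bexI[of _ i]) (auto simp: next_i n_def)
    have left: ?hit if "v = a (2 * m) + b 1" using that by blast
    have right: ?hit if "v = a ((- t) mod n) + b (t mod n)" using that by blast
    obtain w where "v = 2 * w \<or> v = 2 * w + 1" by (metis evenE oddE)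
    then show ?hit
    proof
      assume w: "v = 2 * w"
      have w': "m + 1 \<le> w" "w \<le> 3 * m + 2" using v w by linarith+
      consider "w \<le> m + 1" | "m + 1 < w" "w \<le> m + 2" | "m + 2 < w" "w \<le> 2 * m" | "2 * m < w" "w \<le> 2 * m + 1" | "2 * m + 1 < w" "w \<le> 2 * m + 2" | "2 * m + 2 < w" "w \<le> 3 * m + 1" | "3 * m + 1 < w" by linarith
      then show ?thesis
      proof cases
        case 1
        show ?thesis by (rule row[of "2 * m"]) (use 1 w w' m_ge_2 p in \<open>auto simp: a_def b_def\<close>)
      next
        case 2
        show ?thesis by (rule row[of "0"]) (use 2 w w' m_ge_2 p in \<open>auto simp: a_def b_def\<close>)
      next
        case 3
        show ?thesis by (rule row[of "w - 1"]) (use 3 w w' m_ge_2 p in \<open>auto simp: a_def b_def\<close>)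
      next
        case 4
        show ?thesis by (rule row[of "m"]) (use 4 w w' m_ge_2 p in \<open>auto simp: a_def b_def\<close>)
      next
        case 5
        show ?thesis by (rule left) (use 5 w w' m_ge_2 p in \<open>auto simp: a_def b_def\<close>)
      next
        case 6
        show ?thesis by (rule row[of "w - 2 * m - 2"]) (use 6 w w' m_ge_2 p in \<open>auto simp: a_def b_def\<close>)
      next
        case 7
        show ?thesis by (rule right, unfold tt) (use 7 w w' m_ge_2 p in \<open>auto simp: a_def b_def\<close>)
      qed
    next
      assume w: "v = 2 * w + 1"
      have w': "m + 1 \<le> w" "w \<le> 3 * m + 2" using v w by linarith+
      consider "w \<le> m + 1" | "m + 1 < w" "w \<le> 2 * m" | "2 * m < w" "w \<le> 2 * m + 1" | "2 * m + 1 < w" "w \<le> 3 * m + 1" | "3 * m + 1 < w" by linarith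
      then show ?thesis
      proof cases
        case 1
        show ?thesis by (rule col[of "2 * m"]) (use 1 w w' m_ge_2 p in \<open>auto simp: a_def b_def\<close>)
      next
        case 2
        show ?thesis by (rule col[of "w - 1"]) (use 2 w w' m_ge_2 p in \<open>auto simp: a_def b_def\<close>)
      next
        case 3
        show ?thesis by (rule col[of "m"]) (use 3 w w' m_ge_2 p in \<open>auto simp: a_def b_def\<close>)
      next
        case 4
        show ?thesis by (rule col[of "w - 2 * m - 2"]) (use 4 w w' m_ge_2 p in \<open>auto simp: a_def b_def\<close>)
      next
        case 5
        show ?thesis by (rule row[of "m + 1"]) (use 5 w w' m_ge_2 p in \<open>auto simp: a_def b_def\<close>)
      qed
    qed
  qed
qed

text \<open>The same parity pattern as in \<open>antimagic_two_5\<close>, with other exceptions: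
  columns \<open>1\<close> and \<open>0\<close> (in the indexing by \<open>i\<close>) supply the
  even values \<open>4 * m + 4\<close> and \<open>6 * m + 4\<close>, and row \<open>1\<close>
  supplies \<open>6 * m + 5\<close>. The gaps left for the left and right diagonals are
  \<open>4 * m + 5\<close> and \<open>6 * m + 3\<close>.\<close>

lemma antimagic_two_1:
  assumes p: "m = 3 * p" "t = - 2 * p"
  shows "\<exists>G. antimagic {1, - 1} G"
proof -
  define a where "a i = (if i = 0 then 4 * m + 1 else if i = 1 then 4 * m + 2 else if i < m then 2 * m + 2 + i
    else if i = m then m + 2 else if i = m + 1 then m + 1 else i + 2)" for i
  define b where "b i = (if i = 0 then 1 else if i = 1 then 2 * m + 3 else if i \<le> m then i
    else if i = m + 1 then m + 3 else 2 * m + i)" for i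
  have next_i: "(i + 1) mod n = (if i = 2 * m then 0 else i + 1)" if "0 \<le> i" "i \<le> 2 * m" for i
    using that by (auto simp: n_def)
  have p0: "1 \<le> p" using m_ge_2 p by simp
  have "t mod n = (4 * p + 1) mod n" by (rule mod_shift[where k = "-1"]) (simp add: n_def p)
  then have tt: "(- t) mod n = 2 * p" "t mod n = 4 * p + 1" using p0 by (simp_all add: n_def p)
  show ?thesis
  proof (rule antimagic_two[of a b "2 * m + 2"])
    fix k :: int assume "1 \<le> k" "k \<le> 2 * n"
    then have k: "1 \<le> k" "k \<le> 4 * m + 2" by (simp_all add: n_def)
    have *: "\<exists>i\<in>{0..<n}. a i = k \<or> b i = k" if "0 \<le> i" "i \<le> 2 * m" "a i = k \<or> b i = k" for i
      using that by (intro bexI[of _ i]) (auto simp: n_def)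
    consider "k \<le> 1" | "1 < k" "k \<le> m" | "m < k" "k \<le> m + 1" | "m + 1 < k" "k \<le> m + 2" | "m + 2 < k" "k \<le> m + 3" | "m + 3 < k" "k \<le> 2 * m + 2" | "2 * m + 2 < k" "k \<le> 2 * m + 3" | "2 * m + 3 < k" "k \<le> 3 * m + 1" | "3 * m + 1 < k" "k \<le> 4 * m" | "4 * m < k" "k \<le> 4 * m + 1" | "4 * m + 1 < k"
      by linarith
    then show "\<exists>i\<in>{0..<n}. a i = k \<or> b i = k"
    proof cases
      case 1
      show ?thesis by (rule *[of "0"]) (use 1 k m_ge_2 p in \<open>auto simp: a_def b_def\<close>)
    next
      case 2
      show ?thesis by (rule *[of "k"]) (use 2 k m_ge_2 p in \<open>auto simp: a_def b_def\<close>)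
    next
      case 3
      show ?thesis by (rule *[of "m + 1"]) (use 3 k m_ge_2 p in \<open>auto simp: a_def b_def\<close>)
    next
      case 4
      show ?thesis by (rule *[of "m"]) (use 4 k m_ge_2 p in \<open>auto simp: a_def b_def\<close>)
    next
      case 5
      show ?thesis by (rule *[of "m + 1"]) (use 5 k m_ge_2 p in \<open>auto simp: a_def b_def\<close>)
    next
      case 6
      show ?thesis by (rule *[of "k - 2"]) (use 6 k m_ge_2 p in \<open>auto simp: a_def b_def\<close>)
    next
      case 7
      show ?thesis by (rule *[of "1"]) (use 7 k m_ge_2 p in \<open>auto simp: a_def b_def\<close>)
    next
      case 8
      show ?thesis by (rule *[of "k - 2 * m - 2"]) (use 8 k m_ge_2 p in \<open>auto simp: a_def b_def\<close>)
    next
      case 9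
      show ?thesis by (rule *[of "k - 2 * m"]) (use 9 k m_ge_2 p in \<open>auto simp: a_def b_def\<close>)
    next
      case 10
      show ?thesis by (rule *[of "0"]) (use 10 k m_ge_2 p in \<open>auto simp: a_def b_def\<close>)
    next
      case 11
      show ?thesis by (rule *[of "1"]) (use 11 k m_ge_2 p in \<open>auto simp: a_def b_def\<close>)
    qed
  next
    fix v assume "2 * m + 2 \<le> v" "v \<le> 2 * m + 2 + 2 * n + 1"
    then have v: "2 * m + 2 \<le> v" "v \<le> 6 * m + 5" by (simp_all add: n_def)
    let ?hit = "(\<exists>i\<in>{0..<n}. a i + b i = v) \<or> (\<exists>i\<in>{0..<n}. a i + b ((i + 1) mod n) = v) \<or>
      v = a (2 * m) + b 1 \<or> v = a ((- t) mod n) + b (t mod n)"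
    have row: ?hit if "0 \<le> i" "i \<le> 2 * m" "a i + b i = v" for i
      using that by (intro disjI1 bexI[of _ i]) (auto simp: n_def)
    have col: ?hit if "0 \<le> i" "i \<le> 2 * m" "a i + b (if i = 2 * m then 0 else i + 1) = v" for i
      using that by (intro disjI2 disjI1 bexI[of _ i]) (auto simp: next_i n_def)
    have left: ?hit if "v = a (2 * m) + b 1" using that by blast
    have right: ?hit if "v = a ((- t) mod n) + b (t mod n)" using that by blast
    obtain w where "v = 2 * w \<or> v = 2 * w + 1" by (metis evenE oddE)
    then show ?hit
    proof
      assume w: "v = 2 * w"
      have w': "m + 1 \<le> w" "w \<le> 3 * m + 2" using v w by linarith+
      consider "w \<le> m + 1" | "m + 1 < w" "w \<le> m + 2" | "m + 2 < w" "w \<le> 2 * m" | "2 * m < w" "w \<le> 2 * m + 1" | "2 * m + 1 < w" "w \<le> 2 * m + 2" | "2 * m + 2 < w" "w \<le> 3 * m + 1" | "3 * m + 1 < w" by linarith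
      then show ?thesis
      proof cases
        case 1
        show ?thesis by (rule row[of "m"]) (use 1 w w' m_ge_2 p in \<open>auto simp: a_def b_def\<close>)
      next
        case 2
        show ?thesis by (rule row[of "m + 1"]) (use 2 w w' m_ge_2 p in \<open>auto simp: a_def b_def\<close>)
      next
        case 3
        show ?thesis by (rule row[of "w - m - 1"]) (use 3 w w' m_ge_2 p in \<open>auto simp: a_def b_def\<close>)
      next
        case 4
        show ?thesis by (rule row[of "0"]) (use 4 w w' m_ge_2 p in \<open>auto simp: a_def b_def\<close>)
      next
        case 5
        show ?thesis by (rule col[of "1"]) (use 5 w w' m_ge_2 p in \<open>auto simp: a_def b_def\<close>)
      next
        case 6
        show ?thesis by (rule row[of "w - m - 1"]) (use 6 w w' m_ge_2 p in \<open>auto simp: a_def b_def\<close>)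
      next
        case 7
        show ?thesis by (rule col[of "0"]) (use 7 w w' m_ge_2 p in \<open>auto simp: a_def b_def\<close>)
      qed
    next
      assume w: "v = 2 * w + 1"
      have w': "m + 1 \<le> w" "w \<le> 3 * m + 2" using v w by linarith+
      consider "w \<le> m + 1" | "m + 1 < w" "w \<le> m + 2" | "m + 2 < w" "w \<le> 2 * m" | "2 * m < w" "w \<le> 2 * m + 1" | "2 * m + 1 < w" "w \<le> 2 * m + 2" | "2 * m + 2 < w" "w \<le> 3 * m" | "3 * m < w" "w \<le> 3 * m + 1" | "3 * m + 1 < w" by linarith
      then show ?thesis
      proof cases
        case 1
        show ?thesis by (rule col[of "2 * m"]) (use 1 w w' m_ge_2 p in \<open>auto simp: a_def b_def\<close>)
      next
        case 2
        show ?thesis by (rule col[of "m"]) (use 2 w w' m_ge_2 p in \<open>auto simp: a_def b_def\<close>)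
      next
        case 3
        show ?thesis by (rule col[of "w - m - 1"]) (use 3 w w' m_ge_2 p in \<open>auto simp: a_def b_def\<close>)
      next
        case 4
        show ?thesis by (rule col[of "m + 1"]) (use 4 w w' m_ge_2 p in \<open>auto simp: a_def b_def\<close>)
      next
        case 5
        show ?thesis by (rule left) (use 5 w w' m_ge_2 p in \<open>auto simp: a_def b_def\<close>)
      next
        case 6
        show ?thesis by (rule col[of "w - m - 1"]) (use 6 w w' m_ge_2 p in \<open>auto simp: a_def b_def\<close>)
      next
        case 7
        show ?thesis by (rule right, unfold tt) (use 7 w w' m_ge_2 p in \<open>auto simp: a_def b_def\<close>)
      next
        case 8
        show ?thesis by (rule row[of "1"]) (use 8 w w' m_ge_2 p in \<open>auto simp: a_def b_def\<close>)
      qed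
    qed
  qed
qed

subsection \<open>Density three\<close>

text \<open>The absolute values are \<open>1\<close> and \<open>m + 2, ..., 3 * m + 1\<close>, each
  once. With both signs they leave exactly the deviations from \<open>- (m + 1)\<close> to
  \<open>m + 1\<close> other than \<open>1\<close> and \<open>- 1\<close> for the third class. The
  sequence alternates between two increasing runs, so that its increments take mostly two
  values.\<close>

definition zigzag :: "int \<Rightarrow> int" where
  "zigzag k = (if k = 2 * m - 2 then 3 * m + 1 else if k = 2 * m - 1 then - 1
    else if k = 2 * m then 2 * m + 1 else if even k then m + 2 + k div 2 else 2 * m + 2 + k div 2)"

text \<open>
  The classes \<open>1\<close> and \<open>- 1\<close> carry \<open>zigzag\<close> and its negative, so that the class \<open>z\<close> alone
  determines the rows. Each column receives an increment of \<open>zigzag\<close> together with a value of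
  \<open>g\<close>. The increments are \<open>m\<close> and \<open>1 - m\<close>, apart from three exceptional ones, and so they move the
  range of \<open>g\<close> outside itself.
\<close>

lemma antimagic_three:
  fixes g :: "int \<Rightarrow> int"
  assumes m: "4 \<le> m"
    and z: "\<not> n dvd (z - 1)" "\<not> n dvd (z + 1)"
    and up: "\<And>v. 2 \<le> v \<Longrightarrow> v \<le> m \<Longrightarrow> \<exists>q\<in>{0..m - 2}. g (2 * q) = v"
    and down: "\<And>v. 3 \<le> v \<Longrightarrow> v \<le> m + 1 \<Longrightarrow> (\<exists>q\<in>{0..m - 3}. g (2 * q + 1) = - v) \<or> g (2 * m) = - v"
    and special: "g (2 * m - 3) = - 2" "g (2 * m - 2) = m + 1" "g (2 * m - 1) = 0"
    and diag: "{zigzag ((p + 1) mod n) - zigzag ((p - 1) mod n) + g ((p + h * (z - 1)) mod n),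
        zigzag ((p + t) mod n) - zigzag ((p - t) mod n) + g ((p + t * z - h * (z + 1)) mod n)} = {1, n}"
  shows "\<exists>G. antimagic {1, - 1, z} G"
proof
  \<comment> \<open>\<open>3 * m + 2\<close> is the mean label. The shift by
    \<open>h * (z + 1)\<close> makes each column read \<open>g\<close> at the index of its
    \<open>zigzag\<close> increment. \<open>p\<close> moves everything along the rows and affects
    only the diagonals.\<close>
  define G where "G c i = (if c = 1 then 3 * m + 2 + zigzag ((p - i) mod n)
    else if c = - 1 then 3 * m + 2 - zigzag ((p - i) mod n)
    else 3 * m + 2 + g ((p - h * (z + 1) - i) mod n))" for c i :: int
  have zne: "z \<noteq> 1" "z \<noteq> - 1" using z by auto
  have G: "G 1 i = 3 * m + 2 + zigzag ((p - i) mod n)" "G (- 1) i = 3 * m + 2 - zigzag ((p - i) mod n)"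
    "G z i = 3 * m + 2 + g ((p - h * (z + 1) - i) mod n)" for i
    using zne by (simp_all add: G_def)
  have sum: "(\<Sum>c\<in>{1, - 1, z}. f c) = f 1 + f (- 1) + f z" for f :: "int \<Rightarrow> int"
    using zne by auto
  have card: "card {1, - 1, z} = 3" using zne by auto
  have mod: "(a - b mod n) mod n = (a - b) mod n" for a b by (simp add: mod_simps)
  have left: "ldiag {1, - 1, z} G
      = 9 * m + 6 + (zigzag ((p + 1) mod n) - zigzag ((p - 1) mod n) + g ((p + h * (z - 1)) mod n))"
  proof -
    have "(p - h * (z + 1) - (- z)) mod n = (p + h * (z - 1)) mod n"
      by (rule mod_shift[where k = "- z"]) (use two_h in algebra)
    then show ?thesis unfolding ldiag_def sum G mod by simp
  qed
  have right: "rdiag {1, - 1, z} G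
      = 9 * m + 6 + (zigzag ((p + t) mod n) - zigzag ((p - t) mod n) + g ((p + t * z - h * (z + 1)) mod n))"
  proof -
    have "p - h * (z + 1) - (- t * z) = p + t * z - h * (z + 1)"
      "p - (- t * 1) = p + t" "p - (- t * (- 1)) = p - t"
      by simp_all
    then show ?thesis unfolding rdiag_def sum G mod by (simp only:)
  qed
  have row: "\<exists>i. row {1, - 1, z} G i = 9 * m + 6 + g e" if "0 \<le> e" "e \<le> 2 * m" for e
  proof
    have "(p - h * (z + 1) - (p - h * (z + 1) - e)) mod n = e" using that n_def by simp
    then show "row {1, - 1, z} G (p - h * (z + 1) - e) = 9 * m + 6 + g e"
      unfolding row_def sum G mod by simp
  qed
  have col: "\<exists>u. col {1, - 1, z} G u
      = 9 * m + 6 + (zigzag (if e = 2 * m then 0 else e + 1) - zigzag e + g e)"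
    if "0 \<le> e" "e \<le> 2 * m" for e
  proof
    have "(p - (p - h - e - h * 1)) mod n = (e + 1) mod n"
      by (rule mod_shift[where k = 1]) (use two_h in algebra)
    also have "\<dots> = (if e = 2 * m then 0 else e + 1)" using that by (auto simp: n_def)
    finally have "(p - (p - h - e - h * 1)) mod n = (if e = 2 * m then 0 else e + 1)" .
    moreover have "p - (p - h - e - h * (- 1)) = e" "p - h * (z + 1) - (p - h - e - h * z) = e"
      by (simp_all add: algebra_simps)
    then have "(p - (p - h - e - h * (- 1))) mod n = e"
      "(p - h * (z + 1) - (p - h - e - h * z)) mod n = e"
      using that n_def by simp_all
    ultimately show "col {1, - 1, z} G (p - h - e)
      = 9 * m + 6 + (zigzag (if e = 2 * m then 0 else e + 1) - zigzag e + g e)"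
      unfolding col_def sum G mod by simp
  qed
  have zz: "zigzag (2 * q) = m + 2 + q" if "q \<le> m - 2" for q
    using that by (auto simp: zigzag_def)
  have zz': "zigzag (2 * q + 1) = 2 * m + 2 + q" if "q \<le> m - 2" for q
    using that by (auto simp: zigzag_def)
  have zs: "zigzag (2 * m - 2) = 3 * m + 1" "zigzag (2 * m - 1) = - 1" "zigzag (2 * m) = 2 * m + 1"
    by (simp_all add: zigzag_def)
  have "filling {1, - 1, z} G"
  proof (rule fillingI)
    show "inj_on (\<lambda>c. c mod n) {1, - 1, z}"
    proof (rule inj_onI)
      fix c c' assume *: "c \<in> {1, - 1, z}" "c' \<in> {1, - 1, z}" "c mod n = c' mod n"
      then have "n dvd (c - c')" "n dvd (c' - c)" by (simp_all add: mod_eq_dvd_iff[symmetric])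
      moreover have "\<not> n dvd 2" using m n_def by (intro small_not_dvd) auto
      ultimately show "c = c'" using * z by auto
    qed
    fix k assume "1 \<le> k" "k \<le> n * int (card {1, - 1, z})"
    then have k: "1 \<le> k" "k \<le> 6 * m + 3" unfolding card n_def by simp_all
    have zig: "\<exists>c\<in>{1, - 1, z}. \<exists>i\<in>{0..<n}. G c i = k"
      if "0 \<le> e" "e \<le> 2 * m" "k = 3 * m + 2 + zigzag e \<or> k = 3 * m + 2 - zigzag e" for e
    proof -
      have "(p - (p - e) mod n) mod n = e" unfolding mod using that(1,2) n_def by simp
      then have "G 1 ((p - e) mod n) = k \<or> G (- 1) ((p - e) mod n) = k"
        using that(3) unfolding G by auto
      then show ?thesis using mod_in_residues by blast
    qed
    have val: "\<exists>c\<in>{1, - 1, z}. \<exists>i\<in>{0..<n}. G c i = k"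
      if "0 \<le> e" "e \<le> 2 * m" "k = 3 * m + 2 + g e" for e
    proof -
      have "(p - h * (z + 1) - (p - h * (z + 1) - e) mod n) mod n = e"
        unfolding mod using that(1,2) n_def by simp
      then have "G z ((p - h * (z + 1) - e) mod n) = k" using that(3) unfolding G by simp
      then show ?thesis using mod_in_residues by blast
    qed
    define w where "w = k - (3 * m + 2)"
    have w: "- (3 * m + 1) \<le> w" "w \<le> 3 * m + 1" "k = 3 * m + 2 + w" using k by (auto simp: w_def)
    show "\<exists>c\<in>{1, - 1, z}. \<exists>i\<in>{0..<n}. G c i = k"
    proof (cases "m + 1 < \<bar>w\<bar>")
      case True
      have sign: "k = 3 * m + 2 + \<bar>w\<bar> \<or> k = 3 * m + 2 - \<bar>w\<bar>" using w(3) by linarith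
      have "\<bar>w\<bar> \<le> 3 * m + 1" using w(1,2) by linarith
      then consider "\<bar>w\<bar> \<le> 2 * m" | "2 * m < \<bar>w\<bar>" "\<bar>w\<bar> \<le> 2 * m + 1"
        | "2 * m + 1 < \<bar>w\<bar>" "\<bar>w\<bar> \<le> 3 * m" | "3 * m < \<bar>w\<bar>" "\<bar>w\<bar> \<le> 3 * m + 1"
        by linarith
      then show ?thesis
      proof cases
        case 1
        show ?thesis
          by (rule zig[of "2 * (\<bar>w\<bar> - m - 2)"])
            (use 1 True sign zz[of "\<bar>w\<bar> - m - 2"] in simp_all)
      next
        case 2
        then have "\<bar>w\<bar> = 2 * m + 1" by linarith
        then show ?thesis by (intro zig[of "2 * m"]) (use sign m zs in simp_all)
      next
        case 3
        show ?thesis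
          by (rule zig[of "2 * (\<bar>w\<bar> - 2 * m - 2) + 1"])
            (use 3 sign m zz'[of "\<bar>w\<bar> - 2 * m - 2"] in simp_all)
      next
        case 4
        then have "\<bar>w\<bar> = 3 * m + 1" by linarith
        then show ?thesis by (intro zig[of "2 * m - 2"]) (use sign m zs in simp_all)
      qed
    next
      case False
      then have "- (m + 2) < w" "w \<le> m + 1" by linarith+
      then consider "- (m + 2) < w" "w \<le> - 3" | "- 3 < w" "w \<le> - 2" | "- 2 < w" "w \<le> - 1"
        | "- 1 < w" "w \<le> 0" | "0 < w" "w \<le> 1" | "1 < w" "w \<le> m" | "m < w" "w \<le> m + 1"
        by linarith
      then show ?thesis
      proof cases
        case 1
        then consider q where "q \<in> {0..m - 3}" "g (2 * q + 1) = w" | "g (2 * m) = w"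
          using down[of "- w"] by auto
        then show ?thesis
        proof cases
          case 1
          then show ?thesis using val[of "2 * q + 1"] w by simp
        next
          case 2
          then show ?thesis using val[of "2 * m"] w m by simp
        qed
      next
        case 2
        show ?thesis by (rule val[of "2 * m - 3"]) (use 2 w m special in simp_all)
      next
        case 3
        show ?thesis by (rule zig[of "2 * m - 1"]) (use 3 w m zs in simp_all)
      next
        case 4
        show ?thesis by (rule val[of "2 * m - 1"]) (use 4 w m special in simp_all)
      next
        case 5
        show ?thesis by (rule zig[of "2 * m - 1"]) (use 5 w m zs in simp_all)
      next
        case 6
        then obtain q where "q \<in> {0..m - 2}" "g (2 * q) = w" using up[of w] by auto
        then show ?thesis using val[of "2 * q"] w by simp
      next
        case 7
        show ?thesis by (rule val[of "2 * m - 2"]) (use 7 w m special in simp_all)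
      qed
    qed
  qed simp
  then show "antimagic {1, - 1, z} G"
  proof (rule antimagicI)
    \<comment> \<open>Deviations from the mean \<open>9 * m + 6\<close>: rows give
      \<open>- (m + 1), ..., m + 1\<close> without \<open>1\<close> and \<open>- 1\<close>; columns
      give \<open>- 2 * m, ..., - (m + 2)\<close> and \<open>m + 2, ..., 2 * m\<close>, and from the
      exceptional increments \<open>- 1\<close>, \<open>- (2 * m + 1)\<close> and
      \<open>2 * m + 2\<close>. Only \<open>1\<close> and \<open>n\<close> remain, for the
      diagonals.\<close>
    fix v assume v: "9 * m + 6 - n \<le> v" "v \<le> 9 * m + 6 - n + 2 * n + 1"
    define w where "w = v - (9 * m + 6)"
    have w: "- (2 * m + 1) \<le> w" "w \<le> 2 * m + 2" "v = 9 * m + 6 + w"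
      using v by (auto simp: w_def n_def)
    let ?hit = "(\<exists>i. row {1, - 1, z} G i = v) \<or> (\<exists>u. col {1, - 1, z} G u = v) \<or>
        v = ldiag {1, - 1, z} G \<or> v = rdiag {1, - 1, z} G"
    have R: ?hit if "0 \<le> e" "e \<le> 2 * m" "g e = w" for e
      using row[OF that(1,2)] that(3) w(3) by auto
    have C: ?hit if "0 \<le> e" "e \<le> 2 * m"
      "zigzag (if e = 2 * m then 0 else e + 1) - zigzag e + g e = w" for e
      using col[OF that(1,2)] that(3) w(3) by auto
    have D: ?hit if "w \<in> {1, n}"
    proof -
      have "v - (9 * m + 6) \<in> {1, n}" using that w(3) by simp
      then show ?thesis unfolding diag[symmetric] left right by auto
    qed
    have up_step: "zigzag (2 * q + 1) - zigzag (2 * q) = m" if "q \<le> m - 2" for q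
      using zz[OF that] zz'[OF that] by simp
    have down_step: "zigzag (2 * q + 1 + 1) - zigzag (2 * q + 1) = 1 - m" if "q \<le> m - 3" for q
      using zz'[of q] zz[of "q + 1"] that by (simp add: algebra_simps)
    show ?hit
    proof (cases "w \<le> 0")
      case True
      then consider "w \<le> - (2 * m + 1)" | "- (2 * m + 1) < w" "w \<le> - (m + 2)"
        | "- (m + 2) < w" "w \<le> - 3" | "- 3 < w" "w \<le> - 2" | "- 2 < w" "w \<le> - 1" | "- 1 < w" "w \<le> 0"
        by linarith
      then show ?thesis
      proof cases
        case 1
        show ?thesis by (rule C[of "2 * m - 2"]) (use 1 w m special zs in auto)
      next
        case 2
        then consider q where "q \<in> {0..m - 3}" "g (2 * q + 1) = w + m - 1" | "g (2 * m) = w + m - 1"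
          using down[of "1 - m - w"] by auto
        then show ?thesis
        proof cases
          case 1
          then show ?thesis using C[of "2 * q + 1"] down_step[of q] by auto
        next
          case 2
          then show ?thesis using C[of "2 * m"] m zz[of 0] zs by auto
        qed
      next
        case 3
        then consider q where "q \<in> {0..m - 3}" "g (2 * q + 1) = w" | "g (2 * m) = w"
          using down[of "- w"] by auto
        then show ?thesis
        proof cases
          case 1
          then show ?thesis using R[of "2 * q + 1"] by auto
        next
          case 2
          then show ?thesis using R[of "2 * m"] m by auto
        qed
      next
        case 4
        show ?thesis by (rule R[of "2 * m - 3"]) (use 4 w m special in auto)
      next
        case 5
        show ?thesis
          by (rule C[of "2 * m - 3"]) (use 5 w m special zs zz'[of "m - 2"] in auto)
      next
        case 6
        show ?thesis by (rule R[of "2 * m - 1"]) (use 6 w m special in auto)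
      qed
    next
      case False
      then consider "0 < w" "w \<le> 1" | "1 < w" "w \<le> m" | "m < w" "w \<le> m + 1"
        | "m + 1 < w" "w \<le> 2 * m" | "2 * m < w" "w \<le> 2 * m + 1" | "2 * m + 1 < w"
        by linarith
      then show ?thesis
      proof cases
        case 1
        show ?thesis by (rule D) (use 1 n_def in auto)
      next
        case 2
        then obtain q where "q \<in> {0..m - 2}" "g (2 * q) = w" using up[of w] by auto
        then show ?thesis using R[of "2 * q"] by auto
      next
        case 3
        show ?thesis by (rule R[of "2 * m - 2"]) (use 3 w m special in auto)
      next
        case 4
        then obtain q where "q \<in> {0..m - 2}" "g (2 * q) = w - m" using up[of "w - m"] by auto
        then show ?thesis using C[of "2 * q"] up_step[of q] by auto
      next
        case 5
        show ?thesis by (rule D) (use 5 n_def in auto)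
      next
        case 6
        show ?thesis by (rule C[of "2 * m - 1"]) (use 6 w m special zs in auto)
      qed
    qed
  qed
qed

text \<open>The diagonals involve only \<open>g (2 * m - 4) = m - 2\<close> and
  \<open>g (4 * k + 3) = - 2 * k\<close>, giving \<open>n\<close> on the left and \<open>1\<close>
  on the right. The rest of \<open>g\<close> distributes the remaining values in runs.\<close>

lemma antimagic_three_5:
  assumes k: "1 \<le> k" "m = 3 * k + 2" "t = 2 * k + 2"
  shows "\<exists>G. antimagic {1, - 1, - 7} G"
proof -
  define g where "g e = (if e = 2 * m - 3 then - 2 else if e = 2 * m - 2 then m + 1
    else if e = 2 * m - 1 then 0 else if e = 2 * m then - (m - 2)
    else if even e then (if e div 2 < 2 then m - 1 + e div 2 else e div 2)
    else if e div 2 < 3 then e div 2 - (m + 1) else if e div 2 = 3 then - (m - 3)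
    else 1 - e div 2)" for e
  show ?thesis
  proof (rule antimagic_three[where g = g and p = "2 * m"])
    show "4 \<le> m" using k by simp
    show "\<not> n dvd (- 7 - 1)"
    proof
      assume "n dvd (- 7 - 1)"
      then have "n \<le> 8" using zdvd_imp_le[of n 8] by simp
      with k n_def show False by simp
    qed
    show "\<not> n dvd (- 7 + 1)"
    proof
      assume "n dvd (- 7 + 1)"
      then have "n \<le> 6" using zdvd_imp_le[of n 6] by simp
      with k n_def show False by simp
    qed
    show "\<exists>q\<in>{0..m - 2}. g (2 * q) = v" if v: "2 \<le> v" "v \<le> m" for v
    proof -
      consider "v = m - 1" | "v = m" | "v \<le> m - 2" using v by linarith
      then show ?thesis
      proof cases
        case 1
        then show ?thesis using k by (intro bexI[of _ 0]) (auto simp: g_def)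
      next
        case 2
        then show ?thesis using k by (intro bexI[of _ 1]) (auto simp: g_def)
      next
        case 3
        then show ?thesis using k v by (intro bexI[of _ v]) (auto simp: g_def)
      qed
    qed
    show "(\<exists>q\<in>{0..m - 3}. g (2 * q + 1) = - v) \<or> g (2 * m) = - v" if v: "3 \<le> v" "v \<le> m + 1" for v
    proof -
      consider "m - 1 \<le> v" | "v = m - 2" | "v = m - 3" | "v \<le> m - 4" by linarith
      then show ?thesis
      proof cases
        case 1
        then show ?thesis using k v by (intro disjI1 bexI[of _ "m + 1 - v"]) (auto simp: g_def)
      next
        case 2
        then show ?thesis by (simp add: g_def)
      next
        case 3
        then show ?thesis using k v by (intro disjI1 bexI[of _ 3]) (auto simp: g_def)
      next
        case 4
        then show ?thesis using k v by (intro disjI1 bexI[of _ "v + 1"]) (auto simp: g_def)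
      qed
    qed
    have "(2 * m + 1) mod n = 0" "(2 * m - 1) mod n = 2 * m - 1"
      using k by (simp_all add: n_def)
    moreover have "(2 * m + h * (- 7 - 1)) mod n = 2 * m - 4"
    proof -
      have "(2 * m + h * (- 7 - 1)) mod n = (2 * m - 4) mod n"
        by (rule mod_shift[where k = "- 4"]) (use two_h in algebra)
      then show ?thesis using k by (simp add: n_def)
    qed
    moreover have "(2 * m + t) mod n = 2 * k + 1"
    proof -
      have "(2 * m + t) mod n = (2 * k + 1) mod n"
        by (rule mod_shift[where k = 1]) (simp add: n_def k)
      then show ?thesis using k by (simp add: n_def)
    qed
    moreover have "(2 * m - t) mod n = 4 * k + 2" using k by (simp add: n_def)
    moreover have "(2 * m + t * (- 7) - h * (- 7 + 1)) mod n = 4 * k + 3"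
    proof -
      have "(2 * m + t * (- 7) - h * (- 7 + 1)) mod n = (4 * k + 3) mod n"
        by (rule mod_shift[where k = 1]) (simp add: n_def h_def k)
      then show ?thesis using k by (simp add: n_def)
    qed
    moreover have "zigzag 0 = m + 2" "zigzag (2 * m - 1) = - 1" "zigzag (2 * k + 1) = 2 * m + 2 + k"
      "zigzag (4 * k + 2) = m + 3 + 2 * k"
      unfolding zigzag_def using k by auto
    moreover have "g (2 * m - 4) = m - 2" "g (4 * k + 3) = - 2 * k"
      using k by (auto simp: g_def)
    ultimately show "{zigzag ((2 * m + 1) mod n) - zigzag ((2 * m - 1) mod n)
          + g ((2 * m + h * (- 7 - 1)) mod n),
        zigzag ((2 * m + t) mod n) - zigzag ((2 * m - t) mod n)
          + g ((2 * m + t * (- 7) - h * (- 7 + 1)) mod n)} = {1, n}"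
      using k by (simp only: n_def) auto
  qed (simp_all add: g_def)
qed

text \<open>The left diagonal reads the special value \<open>g (2 * m - 1) = 0\<close> and gives
  \<open>1\<close>; the right one prescribes \<open>g 0 = 2 * k + 1\<close> and gives
  \<open>n\<close>. The even run of \<open>g\<close> skips the value used at
  \<open>0\<close>.\<close>

lemma antimagic_three_1:
  assumes k: "2 \<le> k" "m = 3 * k" "t = - 2 * k"
  shows "\<exists>G. antimagic {1, - 1, - 3} G"
proof -
  define g where "g e = (if e = 2 * m - 3 then - 2 else if e = 2 * m - 2 then m + 1
    else if e = 2 * m - 1 then 0 else if e = 2 * m then - (m + 1)
    else if even e then (if e = 0 then 2 * k + 1 else if e div 2 < 2 * k then e div 2 + 1
      else e div 2 + 2)
    else - 3 - e div 2)" for e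
  show ?thesis
  proof (rule antimagic_three[where g = g and p = 0])
    show "4 \<le> m" using k by simp
    show "\<not> n dvd (- 3 - 1)"
    proof
      assume "n dvd (- 3 - 1)"
      then have "n \<le> 4" using zdvd_imp_le[of n 4] by simp
      with k n_def show False by simp
    qed
    show "\<not> n dvd (- 3 + 1)"
    proof
      assume "n dvd (- 3 + 1)"
      then have "n \<le> 2" using zdvd_imp_le[of n 2] by simp
      with k n_def show False by simp
    qed
    show "\<exists>q\<in>{0..m - 2}. g (2 * q) = v" if v: "2 \<le> v" "v \<le> m" for v
    proof -
      consider "v = 2 * k + 1" | "v \<le> 2 * k" | "2 * k + 2 \<le> v" by linarith
      then show ?thesis
      proof cases
        case 1
        then show ?thesis using k by (intro bexI[of _ 0]) (auto simp: g_def)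
      next
        case 2
        then show ?thesis using k v by (intro bexI[of _ "v - 1"]) (auto simp: g_def)
      next
        case 3
        then show ?thesis using k v by (intro bexI[of _ "v - 2"]) (auto simp: g_def)
      qed
    qed
    show "(\<exists>q\<in>{0..m - 3}. g (2 * q + 1) = - v) \<or> g (2 * m) = - v" if v: "3 \<le> v" "v \<le> m + 1" for v
    proof (cases "v = m + 1")
      case True
      then show ?thesis by (simp add: g_def)
    next
      case False
      then show ?thesis using k v by (intro disjI1 bexI[of _ "v - 3"]) (auto simp: g_def)
    qed
    have "(0 + 1) mod n = 1" using k by (simp add: n_def)
    moreover have "(0 - 1) mod n = 2 * m"
    proof -
      have "(0 - 1) mod n = (2 * m) mod n" by (rule mod_shift[where k = "- 1"]) (simp add: n_def)
      then show ?thesis using k by (simp add: n_def)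
    qed
    moreover have "(0 + h * (- 3 - 1)) mod n = 2 * m - 1"
    proof -
      have "(0 + h * (- 3 - 1)) mod n = (2 * m - 1) mod n"
        by (rule mod_shift[where k = "- 3"]) (simp add: n_def h_def)
      then show ?thesis using k by (simp add: n_def)
    qed
    moreover have "(0 + t) mod n = 4 * k + 1"
    proof -
      have "(0 + t) mod n = (4 * k + 1) mod n"
        by (rule mod_shift[where k = "- 1"]) (simp add: n_def k)
      then show ?thesis using k by (simp add: n_def)
    qed
    moreover have "(0 - t) mod n = 2 * k" using k by (simp add: n_def)
    moreover have "(0 + t * (- 3) - h * (- 3 + 1)) mod n = 0"
    proof -
      have "(0 + t * (- 3) - h * (- 3 + 1)) mod n = 0 mod n"
        by (rule mod_shift[where k = 2]) (simp add: n_def h_def k)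
      then show ?thesis by simp
    qed
    moreover have "zigzag 1 = 2 * m + 2" "zigzag (2 * m) = 2 * m + 1"
      "zigzag (4 * k + 1) = 2 * m + 2 + 2 * k" "zigzag (2 * k) = m + 2 + k"
      unfolding zigzag_def using k by auto
    moreover have "g (2 * m - 1) = 0" "g 0 = 2 * k + 1"
      using k by (auto simp: g_def)
    ultimately show "{zigzag ((0 + 1) mod n) - zigzag ((0 - 1) mod n) + g ((0 + h * (- 3 - 1)) mod n),
        zigzag ((0 + t) mod n) - zigzag ((0 - t) mod n)
          + g ((0 + t * (- 3) - h * (- 3 + 1)) mod n)} = {1, n}"
      using k by (simp only: n_def) auto
  qed (simp_all add: g_def)
qed

subsection \<open>Density four\<close>

text \<open>
  The classes \<open>29\<close> and \<open>33\<close> carry \<open>f\<close> and \<open>- f\<close>, the classes \<open>5\<close> and \<open>- 3\<close> two copies of \<open>g\<close>,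
  with \<open>f\<close> and \<open>g\<close> linear modulo \<open>n\<close>. The rows take the even deviations; in a column, \<open>f\<close>
  contributes an even increment and the two copies of \<open>g\<close> an odd deviation (an even one in a single
  column). The classes are chosen so that both diagonals come out right.
\<close>

lemma antimagic_four:
  assumes cases: "(m = 3 * p + 2 \<and> t = 2 * p + 2) \<or> (m = 3 * p \<and> t = - 2 * p)"
    and n7: "n \<noteq> 7"
  shows "\<exists>G. antimagic {5, - 3, 29, 33} G"
proof
  \<comment> \<open>\<open>q\<close> is the inverse of \<open>4\<close>. In a column the rows of
    classes \<open>5\<close> and \<open>- 3\<close> differ by \<open>8 * h\<close>, that is
    \<open>4\<close>, so the two copies of \<open>g\<close> are read at consecutive arguments;
    classes \<open>29\<close> and \<open>33\<close> are read at arguments \<open>h\<close>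
    apart.\<close>
  define q where "q = h * h"
  \<comment> \<open>Modulo \<open>n\<close> this is \<open>17 * q\<close>, chosen so that in every
    column class \<open>33\<close> has the same argument as class \<open>- 3\<close>.\<close>
  define e where "e = 3 * (1 - m) - q"
  define G where "G c i = (if c = 5 then 3 * n + 1 + (q * i + (m - q)) mod n
    else if c = - 3 then 1 + (q * i + (m - q)) mod n
    else if c = 29 then n + 2 + 2 * ((q * i + (e + m)) mod n)
    else 3 * n - 1 - 2 * ((q * i + (e + m)) mod n))" for c i :: int
  have G: "G 5 i = 3 * n + 1 + (q * i + (m - q)) mod n" "G (- 3) i = 1 + (q * i + (m - q)) mod n"
    "G 29 i = n + 2 + 2 * ((q * i + (e + m)) mod n)"
    "G 33 i = 3 * n - 1 - 2 * ((q * i + (e + m)) mod n)" for i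
    by (simp_all add: G_def)
  have sum: "(\<Sum>c\<in>{5, - 3, 29, 33 :: int}. f c) = f 5 + f (- 3) + f 29 + f 33" for f :: "int \<Rightarrow> int"
    by simp
  have mod: "(q * (i mod n) + b) mod n = (q * i + b) mod n" for i b
    by (metis mod_add_left_eq mod_mult_right_eq)
  have q: "q = m * m + 2 * m + 1" by (simp add: q_def h_def algebra_simps)
  have "4 * q - 1 = n * (n + 2)" unfolding q_def using two_h by algebra
  then have q4: "n dvd (4 * q - 1)" by simp
  note solve = residue_solve[OF q4]
  have row: "row {5, - 3, 29, 33} G i = 7 * n + 3 + 2 * ((q * i + (m - q)) mod n)" for i
    unfolding row_def sum G mod by simp
  have col: "col {5, - 3, 29, 33} G (i + 5 * h)
      = 7 * n + 3 + a - (a + 1) mod n + 2 * ((a + (1 + h)) mod n)"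
    if a: "(q * i + (m - q)) mod n = a" for i a
  proof -
    let ?x = "q * i + (m - q)"
    have "(q * (i + 5 * h - h * 5) + (m - q)) mod n = ?x mod n" by simp
    moreover have "(q * (i + 5 * h - h * (- 3)) + (m - q)) mod n = (?x + 1) mod n"
      by (rule mod_shift[where k = "n * n + 3 * n + 3"]) (unfold q_def, use two_h in algebra)
    moreover have "(q * (i + 5 * h - h * 29) + (e + m)) mod n = (?x + (1 + h)) mod n"
      by (rule mod_shift[where k = "- (3 * n * n + 9 * n + 11)"])
        (unfold e_def q_def, use two_h h_def in algebra)
    moreover have "(q * (i + 5 * h - h * 33) + (e + m)) mod n = (?x + 1) mod n"
      by (rule mod_shift[where k = "- (14 * m * m + 35 * m + 26)"])
        (unfold e_def q_def, use h_def n_def in algebra)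
    moreover have "(?x + b) mod n = (a + b) mod n" for b
      unfolding a[symmetric] by (simp only: mod_add_left_eq)
    ultimately show ?thesis unfolding col_def sum G mod using a by simp
  qed
  have left: "ldiag {5, - 3, 29, 33} G = 8 * n + 3"
  proof -
    let ?x = "q * (- 33) + (e + m)"
    have "(q * (- 5) + (m - q)) mod n = (2 * m - 1) mod n"
      by (rule mod_shift[where k = "- 3 * m - 5"]) (simp add: q n_def algebra_simps)
    moreover have "(2 * m - 1) mod n = 2 * m - 1" using m_ge_2 n_def by simp
    moreover have "(q * (- (- 3)) + (m - q)) mod n = 0 mod n"
      by (rule mod_shift[where k = "m + 2"]) (simp add: q n_def algebra_simps)
    moreover have "(q * (- 29) + (e + m)) mod n = ?x mod n + 1"
    proof -
      \<comment> \<open>A wrap-around of \<open>f\<close> between classes \<open>33\<close> and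
        \<open>29\<close> would spoil the left diagonal; it would force
        \<open>n dvd 7\<close>.\<close>
      have "?x mod n + 1 \<noteq> n"
      proof
        assume "?x mod n + 1 = n"
        then have "n dvd (?x mod n + 1)" by simp
        then have "n dvd (?x + 1)" using dvd_mod_iff[of 1 1 ?x] by (simp add: add.commute)
        then have "n dvd 7"
          by (rule dvd_combine[where a = "- 34 * m - 53" and b = "- 2"])
            (simp add: e_def q n_def algebra_simps)
        then have "n \<le> 7" by (rule zdvd_imp_le) simp
        then have "n = 5" using n7 n_def m_ge_2 by presburger
        with \<open>n dvd 7\<close> show False by simp
      qed
      then have x: "0 \<le> ?x mod n + 1" "?x mod n + 1 < n"
        using mod_in_residues[of ?x] unfolding atLeastLessThan_iff by linarith+
      have "(q * (- 29) + (e + m)) mod n = (?x + 1) mod n"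
        by (rule mod_shift[where k = "n + 2"]) (unfold q_def, use two_h in algebra)
      also have "\<dots> = (?x mod n + 1) mod n" by (simp add: mod_simps)
      also have "\<dots> = ?x mod n + 1" using x by (rule mod_pos_pos_trivial)
      finally show ?thesis .
    qed
    ultimately show ?thesis unfolding ldiag_def sum G mod using n_def by simp
  qed
  have right: "rdiag {5, - 3, 29, 33} G = 9 * n + 2"
    using cases
  proof
    assume p: "m = 3 * p + 2 \<and> t = 2 * p + 2"
    have t3: "3 * t = 1 + n" and p0: "0 \<le> p" using p n_def m_ge_2 by auto
    have "(q * (- t * 5) + (m - q)) mod n = (5 * p + 3) mod n"
      by (rule mod_shift[where k = "- 15 * p * p - 34 * p - 20"]) (unfold q n_def, use p in algebra)
    moreover have "(5 * p + 3) mod n = 5 * p + 3" using p p0 n_def by simp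
    moreover have "(q * (- t * (- 3)) + (m - q)) mod n = m mod n"
      by (rule mod_shift[where k = q]) (use t3 in algebra)
    moreover have "m mod n = m" using m_ge_2 n_def by simp
    moreover have "(q * (- t * 33) + (e + m)) mod n = 1 mod n"
      by (rule mod_shift[where k = "- 11 * q - 6 * m - 10"])
        (unfold e_def q n_def, use t3 n_def in algebra)
    moreover have "1 mod n = 1" using m_ge_2 n_def by simp
    moreover have "(q * (- t * 29) + (e + m)) mod n = (2 * p + 3) mod n"
      by (rule mod_shift[where k = "- 11 * q - 6 * m - 10 + t * (n + 2)"])
        (unfold e_def q n_def, use p in algebra)
    moreover have "(2 * p + 3) mod n = 2 * p + 3" using p p0 n_def by simp
    ultimately show ?thesis unfolding rdiag_def sum G mod using p n_def by simp
  next
    assume p: "m = 3 * p \<and> t = - 2 * p"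
    have t3: "3 * t = 1 - n" and p0: "1 \<le> p" using p n_def m_ge_2 by auto
    have "(q * (- t * 5) + (m - q)) mod n = (p - 1) mod n"
      by (rule mod_shift[where k = "15 * p * p + 6 * p"]) (unfold q n_def, use p in algebra)
    moreover have "(p - 1) mod n = p - 1" using p p0 n_def by simp
    moreover have "(q * (- t * (- 3)) + (m - q)) mod n = m mod n"
      by (rule mod_shift[where k = "- q"]) (use t3 in algebra)
    moreover have "m mod n = m" using m_ge_2 n_def by simp
    moreover have "(q * (- t * 33) + (e + m)) mod n = 1 mod n"
      by (rule mod_shift[where k = "11 * q - 6 * m - 10"])
        (unfold e_def q n_def, use t3 n_def in algebra)
    moreover have "1 mod n = 1" using m_ge_2 n_def by simp
    moreover have "(q * (- t * 29) + (e + m)) mod n = (4 * p + 2) mod n"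
      by (rule mod_shift[where k = "11 * q - 6 * m - 11 + t * (n + 2)"])
        (unfold e_def q n_def, use p in algebra)
    moreover have "(4 * p + 2) mod n = 4 * p + 2" using p p0 n_def by simp
    ultimately show ?thesis unfolding rdiag_def sum G mod using p n_def by simp
  qed
  have "filling {5, - 3, 29, 33} G"
  proof (rule fillingI)
    show "inj_on (\<lambda>c. c mod n) {5, - 3, 29, 33}"
    proof (rule inj_onI)
      fix c c' assume *: "c \<in> {5, - 3, 29, 33 :: int}" "c' \<in> {5, - 3, 29, 33}" "c mod n = c' mod n"
      then have dvd: "n dvd \<bar>c - c'\<bar>" by (simp add: mod_eq_dvd_iff)
      show "c = c'"
      proof (rule ccontr)
        assume "c \<noteq> c'"
        \<comment> \<open>Since \<open>n\<close> is at least \<open>5\<close> and coprime to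
          \<open>6\<close>, it could only divide \<open>28\<close>, with
          \<open>n = 7\<close>.\<close>
        then have diff: "\<bar>c - c'\<bar> \<in> {4, 8, 24, 28, 32, 36}" using *(1,2) by auto
        have "n \<le> \<bar>c - c'\<bar>" using dvd \<open>c \<noteq> c'\<close> by (intro zdvd_imp_le) simp_all
        also have "\<dots> \<le> 36" using diff by auto
        finally have "n \<le> 36" .
        have np: "n = 6 * p + 5 \<or> n = 6 * p + 1" using cases n_def by auto
        then have "0 \<le> p" "p \<le> 5" using \<open>n \<le> 36\<close> n_def m_ge_2 by auto
        then consider "p = 0" | "p = 1" | "p = 2" | "p = 3" | "p = 4" | "p = 5" by linarith
        moreover obtain d where "n dvd d" "d = 4 \<or> d = 8 \<or> d = 24 \<or> d = 28 \<or> d = 32 \<or> d = 36"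
          using dvd diff by blast
        ultimately show False using np n7 n_def m_ge_2 by cases auto
      qed
    qed
    fix k assume "1 \<le> k" "k \<le> n * int (card {5, - 3, 29, 33 :: int})"
    then have k: "1 \<le> k" "k \<le> 4 * n" by simp_all
    consider "k \<le> n" | "n < k" "k \<le> 3 * n" "even (k - n)" | "n < k" "k \<le> 3 * n" "odd (k - n)" | "3 * n < k"
      by linarith
    then show "\<exists>c\<in>{5, - 3, 29, 33}. \<exists>i\<in>{0..<n}. G c i = k"
    proof cases
      case 1
      then obtain i where "i \<in> {0..<n}" "(q * i + (m - q)) mod n = k - 1"
        using solve[of "k - 1" "m - q"] k by auto
      then have "G (- 3) i = k" unfolding G by simp
      then show ?thesis using \<open>i \<in> {0..<n}\<close> by blast
    next
      case 2
      then obtain w where w: "k - n = 2 * w" by (elim evenE)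
      then obtain i where "i \<in> {0..<n}" "(q * i + (e + m)) mod n = w - 1"
        using solve[of "w - 1" "e + m"] 2 by auto
      then have "G 29 i = k" unfolding G using w by simp
      then show ?thesis using \<open>i \<in> {0..<n}\<close> by blast
    next
      case 3
      then obtain w where w: "k - n = 2 * w + 1" by (elim oddE)
      then obtain i where "i \<in> {0..<n}" "(q * i + (e + m)) mod n = n - 1 - w"
        using solve[of "n - 1 - w" "e + m"] 3 by auto
      then have "G 33 i = k" unfolding G using w by simp
      then show ?thesis using \<open>i \<in> {0..<n}\<close> by blast
    next
      case 4
      then obtain i where "i \<in> {0..<n}" "(q * i + (m - q)) mod n = k - 1 - 3 * n"
        using solve[of "k - 1 - 3 * n" "m - q"] k by auto
      then have "G 5 i = k" unfolding G by simp
      then show ?thesis using \<open>i \<in> {0..<n}\<close> by blast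
    qed
  qed simp
  then show "antimagic {5, - 3, 29, 33} G"
  proof (rule antimagicI)
    \<comment> \<open>Rows give \<open>7 * n + 3, 7 * n + 5, ..., 9 * n + 1\<close>. Columns give
      \<open>7 * n + 2, 7 * n + 4, ..., 9 * n\<close> except \<open>8 * n + 3\<close>, and the
      column with \<open>a = 2 * m\<close>, where \<open>a + 1\<close> wraps around, gives
      \<open>9 * n + 3\<close>. The diagonals fill the gaps \<open>8 * n + 3\<close> and
      \<open>9 * n + 2\<close>.\<close>
    fix v assume v: "7 * n + 2 \<le> v" "v \<le> 7 * n + 2 + 2 * n + 1"
    let ?hit = "(\<exists>i. row {5, - 3, 29, 33} G i = v) \<or> (\<exists>u. col {5, - 3, 29, 33} G u = v) \<or>
        v = ldiag {5, - 3, 29, 33} G \<or> v = rdiag {5, - 3, 29, 33} G"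
    have R: ?hit if a: "0 \<le> a" "a \<le> 2 * m" "v = 7 * n + 3 + 2 * a" for a
    proof -
      obtain i where "(q * i + (m - q)) mod n = a" using solve[of a "m - q"] a n_def by auto
      then show ?thesis using row[of i] a(3) by auto
    qed
    have C: ?hit if a: "0 \<le> a" "a \<le> 2 * m"
      "v = 7 * n + 3 + a - (a + 1) mod n + 2 * ((a + (1 + h)) mod n)" for a
    proof -
      obtain i where "(q * i + (m - q)) mod n = a" using solve[of a "m - q"] a n_def by auto
      from col[OF this] show ?thesis using a(3) by auto
    qed
    obtain w where "v - (7 * n + 2) = 2 * w \<or> v - (7 * n + 2) = 2 * w + 1" by (metis evenE oddE)
    then show ?hit
    proof
      assume w: "v - (7 * n + 2) = 2 * w"
      then have w0: "0 \<le> w" "w \<le> 2 * m + 1" using v n_def by auto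
      consider "w \<le> m" | "w = m + 1" | "m + 1 < w" "w \<le> 2 * m" | "w = 2 * m + 1" using w0 by linarith
      then show ?thesis
      proof cases
        case 1
        have "(w + m - 1 + 1) mod n = w + m" using 1 w0 m_ge_2 n_def by simp
        moreover have "(w + m - 1 + (1 + h)) mod n = w mod n"
          by (rule mod_shift[where k = 1]) (simp add: n_def h_def)
        moreover have "w mod n = w" using 1 w0 n_def by simp
        ultimately show ?thesis using 1 w w0 m_ge_2 by (intro C[of "w + m - 1"]) simp_all
      next
        case 2
        then show ?thesis using w left n_def by simp
      next
        case 3
        have "(w - m - 2 + 1) mod n = w - m - 1" "(w - m - 2 + (1 + h)) mod n = w"
          using 3 m_ge_2 n_def h_def by simp_all
        then show ?thesis using 3 w m_ge_2 by (intro C[of "w - m - 2"]) simp_all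
      next
        case 4
        then show ?thesis using w right n_def by simp
      qed
    next
      assume w: "v - (7 * n + 2) = 2 * w + 1"
      then have w0: "0 \<le> w" "w \<le> 2 * m + 1" using v n_def by auto
      show ?thesis
      proof (cases "w \<le> 2 * m")
        case True
        then show ?thesis using w w0 by (intro R[of w]) simp_all
      next
        case False
        then have "w = 2 * m + 1" using w0 by simp
        moreover have "(2 * m + 1) mod n = 0" by (simp add: n_def)
        moreover have "(2 * m + (1 + h)) mod n = h"
        proof -
          have "(2 * m + (1 + h)) mod n = h mod n"
            by (rule mod_shift[where k = 1]) (simp add: n_def)
          then show ?thesis using m_ge_2 by (simp add: n_def h_def)
        qed
        ultimately show ?thesis using w n_def h_def m_ge_2 by (intro C[of "2 * m"]) simp_all
      qed
    qed
  qed
qed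

subsection \<open>All densities\<close>

lemma card_symmetric:
  assumes "P \<subseteq> {1..m}"
  shows "card (P \<union> uminus ` P) = 2 * card P"
proof -
  have "finite P" using assms finite_subset by blast
  moreover have "x \<notin> uminus ` P" if "x \<in> P" for x
  proof
    assume "x \<in> uminus ` P"
    then obtain y where "y \<in> P" "x = - y" by blast
    moreover have "x \<in> {1..m}" "y \<in> {1..m}" using \<open>y \<in> P\<close> that assms by blast+
    ultimately show False by simp
  qed
  then have "P \<inter> uminus ` P = {}" by blast
  ultimately show ?thesis by (simp add: card_Un_disjoint card_image)
qed

text \<open>\<open>S\<close> is a supply of pairs \<open>x\<close>, \<open>- x\<close> of free
  transversals; each of the \<open>k\<close> blocks consumes two pairs.\<close>

lemma antimagic_extend:
  assumes C: "antimagic C G" and P: "S \<subseteq> {1..m}" "2 * k \<le> card S"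
    and apart: "\<And>c x. c \<in> C \<Longrightarrow> x \<in> S \<Longrightarrow> \<not> n dvd (c - x) \<and> \<not> n dvd (c + x)"
  shows "\<exists>D F. antimagic D F \<and> card D = card C + 4 * k"
proof -
  obtain P where P: "P \<subseteq> S" "card P = 2 * k" using obtain_subset_with_card_n[OF P(2)] by metis
  then have P1: "P \<subseteq> {1..m}" using assms(2) by blast
  then obtain F s where F: "magic (P \<union> uminus ` P) F s" using magic_blocks P(2) by blast
  have ap: "apart C (P \<union> uminus ` P)" unfolding apart_def using apart P(1) by fastforce
  have "finite C" "finite (P \<union> uminus ` P)"
    using C F by (auto simp: antimagic_def magic_def semimagic_def filling_def)
  then have "card (C \<union> (P \<union> uminus ` P)) = card C + 4 * k"
    using apart_disjoint[OF ap] card_symmetric[OF P1] P(2) by (simp add: card_Un_disjoint)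
  then show ?thesis using antimagic_join[OF C F ap] by blast
qed

lemma apart_small:
  assumes "C \<subseteq> {- m..m}" "D \<subseteq> {- m..m}" "C \<inter> D = {}"
  shows "apart C D"
  unfolding apart_def
proof (intro ballI small_not_dvd)
  fix c d assume "c \<in> C" "d \<in> D"
  then have "c \<in> {- m..m}" "d \<in> {- m..m}" "c \<noteq> d" using assms by blast+
  then show "\<bar>c - d\<bar> < n" "c - d \<noteq> 0" using n_def by auto
qed

lemma inj_mod_small:
  assumes "C \<subseteq> {- m..m}"
  shows "inj_on (\<lambda>c. c mod n) C"
proof (rule inj_onI)
  fix c d assume *: "c \<in> C" "d \<in> C" "c mod n = d mod n"
  then have "n dvd (c - d)" by (simp add: mod_eq_dvd_iff)
  moreover have "c \<in> {- m..m}" "d \<in> {- m..m}" using * assms by blast+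
  then have "\<bar>c - d\<bar> < n" using n_def by auto
  ultimately show "c = d" using small_not_dvd[of "c - d"] by auto
qed

lemma not_dvd_small:
  assumes "c \<in> {- m..m}" "x \<in> {1..m}" "\<bar>c\<bar> \<noteq> x"
  shows "\<not> n dvd (c - x) \<and> \<not> n dvd (c + x)"
  using assms n_def by (intro conjI small_not_dvd) auto

lemma antimagic_exists:
  assumes cases: "(m = 3 * p + 2 \<and> t = 2 * p + 2) \<or> (m = 3 * p \<and> t = - 2 * p)"
    and d: "2 \<le> d" "int d \<le> 2 * m"
    and d3: "d = 3 \<longrightarrow> 5 \<le> m" and d4: "d = 4 \<longrightarrow> m \<noteq> 3"
  shows "\<exists>C G. antimagic C G \<and> card C = d"
proof -
  have two: "\<exists>G. antimagic {1, - 1} G"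
    using cases antimagic_two_5 antimagic_two_1 by blast
  have p0: "0 \<le> p" using cases m_ge_2 by auto
  have m4: "m \<noteq> 4" using cases by presburger
  have "d = 4 \<or> (\<exists>k. d = 8 + 4 * k) \<or> (\<exists>k. d = 5 + 4 * k) \<or> (\<exists>k. d = 2 + 4 * k) \<or> (\<exists>k. d = 3 + 4 * k)"
    using d(1) by presburger
  then consider "d = 4" | k where "d = 8 + 4 * k" | k where "d = 5 + 4 * k"
    | k where "d = 2 + 4 * k" | k where "d = 3 + 4 * k"
    by blast
  then show ?thesis
  proof cases
    case 1
    then have "n \<noteq> 7" using d4 n_def by auto
    then obtain G where "antimagic {5, - 3, 29, 33} G" using antimagic_four[OF cases] by blast
    moreover have "card {5, - 3, 29, 33 :: int} = d" using 1 by simp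
    ultimately show ?thesis by blast
  next
    case (2 k)
    then have m: "5 \<le> m" using d m4 by linarith
    \<comment> \<open>The triple \<open>2, 3, 4\<close> avoids class \<open>1\<close> and is
      disjoint from its negative, so its rotated complement fits beside it.\<close>
    have triple: "{3 + 1, 3 - 1, 3} \<subseteq> {- m..m}" using m by auto
    obtain G s where G: "semimagic {3 + 1, 3 - 1, 3} G s"
      using triple_exists[OF inj_mod_small[OF triple], of 1] by auto
    have "apart {3 + 1, 3 - 1, 3} (uminus ` {3 + 1, 3 - 1, 3})"
      using m by (intro apart_small) auto
    from magic_rotate[OF G this] obtain F s' where
      F: "magic ({3 + 1, 3 - 1, 3} \<union> uminus ` {3 + 1, 3 - 1, 3}) F s'" by blast
    have set: "{3 + 1, 3 - 1, 3} \<union> uminus ` {3 + 1, 3 - 1, 3} = {2, 3, 4, - 2, - 3, - 4 :: int}"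
      by auto
    obtain H where H: "antimagic {1, - 1} H" using two by blast
    have "apart {1, - 1} {2, 3, 4, - 2, - 3, - 4}" using m by (intro apart_small) auto
    from antimagic_join[OF H F[unfolded set] this]
    obtain H' where H': "antimagic ({1, - 1} \<union> {2, 3, 4, - 2, - 3, - 4}) H'" by blast
    have "\<exists>D F. antimagic D F \<and> card D = card ({1, - 1} \<union> {2, 3, 4, - 2, - 3, - 4 :: int}) + 4 * k"
      using m d 2 by (intro antimagic_extend[OF H', where S = "{5..m}"] not_dvd_small) auto
    moreover have "card ({1, - 1} \<union> {2, 3, 4, - 2, - 3, - 4 :: int}) = 8" by simp
    ultimately show ?thesis unfolding 2 by metis
  next
    case (3 k)
    then have m: "3 \<le> m" using d by linarith
    have triple: "{0 + 2, 0 - 2, 0} \<subseteq> {- m..m}" using m by auto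
    have "n dvd (2 * h - 1)" using two_h by simp
    then obtain F s where F: "magic {0 + 2, 0 - 2, 0} F s"
      using triple_exists[OF inj_mod_small[OF triple] _ \<open>n dvd (2 * h - 1)\<close>] by auto
    obtain H where H: "antimagic {1, - 1} H" using two by blast
    have "apart {1, - 1} {0 + 2, 0 - 2, 0}" using m by (intro apart_small) auto
    from antimagic_join[OF H F this]
    obtain H' where H': "antimagic ({1, - 1} \<union> {0 + 2, 0 - 2, 0}) H'" by blast
    have "\<exists>D F. antimagic D F \<and> card D = card ({1, - 1} \<union> {0 + 2, 0 - 2, 0 :: int}) + 4 * k"
      using m d 3 by (intro antimagic_extend[OF H', where S = "{3..m}"] not_dvd_small) auto
    moreover have "card ({1, - 1} \<union> {0 + 2, 0 - 2, 0 :: int}) = 5" by simp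
    ultimately show ?thesis unfolding 3 by metis
  next
    case (4 k)
    obtain H where H: "antimagic {1, - 1} H" using two by blast
    have "\<exists>D F. antimagic D F \<and> card D = card {1, - 1 :: int} + 4 * k"
      using m_ge_2 d 4 by (intro antimagic_extend[OF H, where S = "{2..m}"] not_dvd_small) auto
    moreover have "card {1, - 1 :: int} = 2" by simp
    ultimately show ?thesis unfolding 4 by metis
  next
    case (5 k)
    then have m: "5 \<le> m" using d d3 m4 by (cases "k = 0") auto
    \<comment> \<open>The transversal \<open>z\<close> is congruent to \<open>w\<close> or
      \<open>- w\<close>, and this one pair is lost for the extension.\<close>
    have "\<exists>z w H. antimagic {1, - 1, z} H \<and> z \<noteq> 1 \<and> z \<noteq> - 1 \<and> w \<in> {2..m} \<and>
        (\<forall>x\<in>{2..m} - {w}. \<not> n dvd (z - x) \<and> \<not> n dvd (z + x))"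
      using cases
    proof
      assume p: "m = 3 * p + 2 \<and> t = 2 * p + 2"
      then obtain H where H: "antimagic {1, - 1, - 7} H" using antimagic_three_5[of p] m by auto
      show ?thesis
      \<comment> \<open>For \<open>n = 11\<close> class \<open>- 7\<close> is class
        \<open>4\<close>, so the lost pair is that of \<open>4\<close>; from \<open>m = 8\<close> on
        it is that of \<open>7\<close>.\<close>
      proof (cases "m = 5")
        case True
        then have n: "n = 11" using n_def by simp
        have "\<not> n dvd (- 7 - x) \<and> \<not> n dvd (- 7 + x)" if x: "x \<in> {2..m} - {4}" for x
        proof -
          consider "x = 2" | "x = 3" | "x = 5" using x True by force
          then show ?thesis unfolding n by cases simp_all
        qed
        then show ?thesis using H m
          by (intro exI[of _ "- 7"] exI[of _ 4] exI[of _ H]) auto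
      next
        case False
        then have "8 \<le> m" using p m by presburger
        then show ?thesis using H
          by (intro exI[of _ "- 7"] exI[of _ 7] exI[of _ H] conjI ballI not_dvd_small) auto
      qed
    next
      assume p: "m = 3 * p \<and> t = - 2 * p"
      then obtain H where H: "antimagic {1, - 1, - 3} H" using antimagic_three_1[of p] m by auto
      then show ?thesis using m
        by (intro exI[of _ "- 3"] exI[of _ 3] exI[of _ H] conjI ballI not_dvd_small) auto
    qed
    then obtain z w H where H: "antimagic {1, - 1, z} H" and z: "z \<noteq> 1" "z \<noteq> - 1" and w: "w \<in> {2..m}"
      and zw: "\<And>x. x \<in> {2..m} - {w} \<Longrightarrow> \<not> n dvd (z - x) \<and> \<not> n dvd (z + x)"
      by blast
    have "card ({2..m} - {w}) = nat (m - 2)" using w by simp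
    \<comment> \<open>\<open>3 + 4 * k\<close> is odd and at most \<open>2 * m\<close>, so the
      remaining \<open>m - 2\<close> pairs are enough.\<close>
    then have size: "2 * k \<le> card ({2..m} - {w})" using d 5 by simp
    have far: "\<not> n dvd (c - x) \<and> \<not> n dvd (c + x)"
      if c: "c \<in> {1, - 1, z}" and x: "x \<in> {2..m} - {w}" for c x
    proof (cases "c = z")
      case True
      then show ?thesis using zw[OF x] by blast
    next
      case False
      then show ?thesis using c x m by (intro not_dvd_small) auto
    qed
    have "\<exists>D F. antimagic D F \<and> card D = card {1, - 1, z} + 4 * k"
      by (rule antimagic_extend[OF H _ size far]) auto
    moreover have "card {1, - 1, z} = 3" using z by simp
    ultimately show ?thesis unfolding 5 by metis
  qed
qed

end

text \<open>
  The general fills of densities three and four break down in three small cases, for which the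
  arrays were found by computer search.
\<close>

lemma regular_sams_5_3: "\<exists>A. regular_sams 5 3 A"
proof -
  interpret odd_order 5 2 3 2 by unfold_locales simp_all
  define G :: "int \<Rightarrow> int \<Rightarrow> int" where
    "G c i = [[13, 4, 12, 11, 8], [6, 15, 7, 14, 9], [1, 2, 5, 3, 10]] ! nat c ! nat i" for c i
  have upto: "{0..<5 :: int} = {0, 1, 2, 3, 4}" by auto
  have "filling {0, 1, 2} G"
    unfolding filling_def upto by (simp add: G_def insert_Times_insert upto_rec1 flip: set_upto)
  moreover have "{19..<19 + 2 * 5 + 2} = set [19..30 :: int]" unfolding set_upto by auto
  then have "{19..<19 + 2 * 5 + 2} \<subseteq> row {0, 1, 2} G ` {0..<5} \<union> col {0, 1, 2} G ` {0..<5}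
      \<union> {ldiag {0, 1, 2} G, rdiag {0, 1, 2} G}"
    unfolding upto row_def col_def ldiag_def rdiag_def
    by (simp add: G_def upto_rec1 del: set_upto)
  ultimately have "antimagic {0, 1, 2} G" unfolding antimagic_def by blast
  moreover have "card {0, 1, 2 :: int} = 3" by simp
  ultimately show ?thesis using antimagic_imp_regular_sams[of "{0, 1, 2}" G] by (simp only:) simp
qed

lemma regular_sams_7_3: "\<exists>A. regular_sams 7 3 A"
proof -
  interpret odd_order 7 3 4 "- 2" by unfold_locales simp_all
  define G :: "int \<Rightarrow> int \<Rightarrow> int" where "G c i = [[17, 9, 2, 6, 16, 10, 20], [1, 19, 15, 21, 5, 18, 13],
    [12, 7, 14, 11, 8, 4, 3]] ! nat c ! nat i" for c i
  have upto: "{0..<7 :: int} = {0, 1, 2, 3, 4, 5, 6}" by auto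
  have "filling {0, 1, 2} G"
    unfolding filling_def upto by (simp add: G_def insert_Times_insert upto_rec1 flip: set_upto)
  moreover have "{26..<26 + 2 * 7 + 2} = set [26..41 :: int]" unfolding set_upto by auto
  then have "{26..<26 + 2 * 7 + 2} \<subseteq> row {0, 1, 2} G ` {0..<7} \<union> col {0, 1, 2} G ` {0..<7}
      \<union> {ldiag {0, 1, 2} G, rdiag {0, 1, 2} G}"
    unfolding upto row_def col_def ldiag_def rdiag_def
    by (simp add: G_def upto_rec1 del: set_upto)
  ultimately have "antimagic {0, 1, 2} G" unfolding antimagic_def by blast
  moreover have "card {0, 1, 2 :: int} = 3" by simp
  ultimately show ?thesis using antimagic_imp_regular_sams[of "{0, 1, 2}" G] by (simp only:) simp
qed

lemma regular_sams_7_4: "\<exists>A. regular_sams 7 4 A"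
proof -
  interpret odd_order 7 3 4 "- 2" by unfold_locales simp_all
  define G :: "int \<Rightarrow> int \<Rightarrow> int" where "G c i = [[20, 25, 22, 3, 17, 1, 14], [4, 15, 21, 24, 16, 19, 26],
    [9, 12, 10, 28, 18, 8, 7], [27, 11, 13, 2, 5, 23, 6]] ! nat c ! nat i" for c i
  have upto: "{0..<7 :: int} = {0, 1, 2, 3, 4, 5, 6}" by auto
  have "filling {0, 1, 2, 3} G"
    unfolding filling_def upto by (simp add: G_def insert_Times_insert upto_rec1 flip: set_upto)
  moreover have "{51..<51 + 2 * 7 + 2} = set [51..66 :: int]" unfolding set_upto by auto
  then have "{51..<51 + 2 * 7 + 2} \<subseteq> row {0, 1, 2, 3} G ` {0..<7} \<union> col {0, 1, 2, 3} G ` {0..<7}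
      \<union> {ldiag {0, 1, 2, 3} G, rdiag {0, 1, 2, 3} G}"
    unfolding upto row_def col_def ldiag_def rdiag_def
    by (simp add: G_def upto_rec1 del: set_upto)
  ultimately have "antimagic {0, 1, 2, 3} G" unfolding antimagic_def by blast
  moreover have "card {0, 1, 2, 3 :: int} = 4" by simp
  ultimately show ?thesis using antimagic_imp_regular_sams[of "{0, 1, 2, 3}" G] by (simp only:) simp
qed

section \<open>The lower bound on the density and the equivalence\<close>

lemma regular_sams_density_ge_2:
  assumes "regular_sams n d A"
  shows "2 \<le> d"
proof (rule ccontr)
  assume "\<not> 2 \<le> d"
  then have d: "d = 1" using assms by (auto simp: regular_sams_def sams_def)
  have bound: "A i j \<le> n" if "i \<in> {1..n}" "j \<in> {1..n}" for i j
    using assms that by (auto simp: regular_sams_def sams_def d)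
  have single: "(\<Sum>i = 1..n. f i) \<le> n"
    if f: "\<And>i. i \<in> {1..n} \<Longrightarrow> f i \<le> n" "card {i \<in> {1..n}. 0 < f i} = 1" for f
  proof -
    obtain k where k: "{i \<in> {1..n}. 0 < f i} = {k}" using f(2) by (auto simp: card_1_singleton_iff)
    have "(\<Sum>i = 1..n. f i) = (\<Sum>i\<in>{k}. f i)"
      unfolding k[symmetric] by (intro sum.mono_neutral_right) auto
    also have "\<dots> \<le> n" using f(1)[of k] k by auto
    finally show ?thesis .
  qed
  have "row_sum n A i \<le> n" if "i \<in> {1..n}" for i
    unfolding row_sum_def using assms bound that by (intro single) (simp_all add: regular_sams_def d)
  moreover have "col_sum n A j \<le> n" if "j \<in> {1..n}" for j
    unfolding col_sum_def using assms bound that by (intro single) (simp_all add: regular_sams_def d)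
  moreover have "left_diag_sum n A \<le> n"
    unfolding left_diag_sum_def using assms bound by (intro single) (simp_all add: regular_sams_def d)
  moreover have "right_diag_sum n A \<le> n"
    unfolding right_diag_sum_def
  proof (rule single)
    show "A i (n + 1 - i) \<le> n" if "i \<in> {1..n}" for i using that by (intro bound) auto
  qed (use assms in \<open>simp add: regular_sams_def d\<close>)
  ultimately have "line_sums n A \<subseteq> {0..n}"
    unfolding line_sums_def by auto
  moreover obtain s where "line_sums n A = {s..<s + (2 * n + 2)}"
    using assms by (auto simp: regular_sams_def sams_def)
  ultimately have "card {s..<s + (2 * n + 2)} \<le> card {0..n}"
    by (intro card_mono) auto
  then show False by simp
qed

theorem theorem1p3:
  fixes n d :: nat
  assumes "n \<ge> 5" and "n mod 6 = 1 \<or> n mod 6 = 5"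
  shows "(\<exists>A. regular_sams n d A) \<longleftrightarrow> 2 \<le> d \<and> d \<le> n - 1"
proof
  assume "\<exists>A. regular_sams n d A"
  then show "2 \<le> d \<and> d \<le> n - 1"
    using regular_sams_density_ge_2 by (auto simp: regular_sams_def sams_def)
next
  assume d: "2 \<le> d \<and> d \<le> n - 1"
  define m where "m = int (n div 2)"
  define p where "p = int (n div 6)"
  \<comment> \<open>\<open>t\<close> is \<open>(n + 1) / 3\<close> or \<open>(1 - n) / 3\<close>,
    whichever is an integer.\<close>
  define t where "t = (if n mod 6 = 5 then 2 * p + 2 else - 2 * p)"
  have n: "n = 6 * (n div 6) + n mod 6" by simp
  have "n div 2 = 3 * (n div 6) + (if n mod 6 = 5 then 2 else 0)"
    using assms(2) by presburger
  then have m: "m = 3 * p + (if n mod 6 = 5 then 2 else 0)" by (simp add: m_def p_def)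
  have cases: "(m = 3 * p + 2 \<and> t = 2 * p + 2) \<or> (m = 3 * p \<and> t = - 2 * p)"
    using m by (auto simp: t_def)
  have "n = 2 * (n div 2) + 1" using assms(2) by presburger
  then have nm: "int n = 2 * m + 1" by (simp add: m_def)
  interpret odd_order "int n" m "m + 1" t
  proof
    show "2 \<le> m" using assms(1) nm by simp
    show "3 * t = 1 + int n \<or> 3 * t = 1 - int n" using cases nm by auto
  qed (use nm in simp_all)
  consider "d = 3" "m = 2" | "d = 3" "m = 3" | "d = 4" "m = 3"
    | "d = 3 \<longrightarrow> 5 \<le> m" "d = 4 \<longrightarrow> m \<noteq> 3"
    using m_ge_2 cases by fastforce
  then show "\<exists>A. regular_sams n d A"
  proof cases
    case 1
    then have "n = 5" using nm by simp
    then show ?thesis using regular_sams_5_3 1 by simp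
  next
    case 2
    then have "n = 7" using nm by simp
    then show ?thesis using regular_sams_7_3 2 by simp
  next
    case 3
    then have "n = 7" using nm by simp
    then show ?thesis using regular_sams_7_4 3 by simp
  next
    case 4
    have "int d \<le> 2 * m" using d nm by linarith
    then obtain C G where CG: "antimagic C G" "card C = d"
      using antimagic_exists[OF cases _ _ 4] d by blast
    have "\<exists>A. regular_sams (nat (int n)) (card C) A"
      by (rule antimagic_imp_regular_sams[OF CG(1)]) (use d nm CG(2) in linarith)+
    then show ?thesis unfolding CG(2) nat_int .
  qed
qed

end
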